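(* Let $F$ be a field, $V$ a non-zero finite dimensional $F$-vector space, and $f:V\times V\to F$ a bilinear form. Suppose $f$ is non-degenerate and indecomposable, and that its asymmetry $\sigma$ has exactly two elementary divisors $p^m,p^m$, where $p=X-\varepsilon$ with $\varepsilon\in\{1,-1\}$, and $m\geq 1$. (i) If $\mathrm{char}(F)\neq 2$ then $f$ has Gram matrix $$\begin{pmatrix}0&J_m(\varepsilon)'\\ I_m&0\end{pmatrix}$$ relative to some basis of $V$, so the equivalence class of $f$ is completely determined by the similarity type of $\sigma$ (i.e. any two non-degenerate and indecomposable bilinear forms on non-zero finite dimensional $F$-vector spaces, each of whose asymmetries has exactly two elementary divisors, these being equal to each other and of the form $(X-\delta)^k$ with $\delta\in\{1,-1\}$ and $k\geq 1$, are equivalent whenever their asymmetries are similar). (ii) The same conclusion follows if $\mathrm{char}(F)=2$ and $F$ has no separable quadratic extensions.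
   Context: $J_m(\lambda)$ is the $m\times m$ lower triangular Jordan block with $\lambda$ on the diagonal and $1$ on the subdiagonal; $I_m$ is the identity matrix; $A'$ is the transpose of $A$. The Gram matrix of $f$ relative to a basis $v_1,\dots,v_n$ of $V$ is $(f(v_i,v_j))$; $f$ is non-degenerate if its Gram matrices are invertible. Forms $f:V\times V\to F$ and $g:W\times W\to F$ are equivalent if there is a linear isomorphism $x:V\to W$ with $g(xu,xv)=f(u,v)$ for all $u,v\in V$. Write $V=U_1\perp U_2$ if $V=U_1\oplus U_2$ and $f(U_1,U_2)=0=f(U_2,U_1)$; $f$ is indecomposable if $V=U_1\perp U_2$ only when $U_1=0$ or $U_2=0$. If $f$ is non-degenerate, its asymmetry is the unique $\sigma\in\mathrm{GL}(V)$ with $f(v,u)=f(u,\sigma v)$ for all $u,v\in V$. Elementary divisors of $\sigma$ are those of $V$ as an $F[X]$-module with $X$ acting as $\sigma$. *)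

theory Defs
  imports
    "HOL-Computational_Algebra.Computational_Algebra"
    "HOL-Algebra.Embedded_Algebras"
    "Jordan_Normal_Form.Jordan_Normal_Form"
begin

text \<open>
  A vector space over the type-class field \<open>'a\<close> is the whole of a type \<open>'v\<close> with a scalar
  multiplication \<open>scale\<close>, as in the locale \<open>vector_space\<close> of HOL. Bases are ordered, that is, lists.
\<close>

subsection \<open>Bilinear forms\<close>

definition bilinear_form :: "('a::field \<Rightarrow> 'v::ab_group_add \<Rightarrow> 'v) \<Rightarrow> ('v \<Rightarrow> 'v \<Rightarrow> 'a) \<Rightarrow> bool" where
  "bilinear_form scale f \<longleftrightarrow>
     (\<forall>u. Vector_Spaces.linear scale (*) (\<lambda>v. f u v)) \<and>
     (\<forall>v. Vector_Spaces.linear scale (*) (\<lambda>u. f u v))"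

definition is_basis :: "('a::field \<Rightarrow> 'v::ab_group_add \<Rightarrow> 'v) \<Rightarrow> 'v list \<Rightarrow> bool" where
  "is_basis scale vs \<longleftrightarrow>
     distinct vs \<and> \<not> module.dependent scale (set vs) \<and> module.span scale (set vs) = UNIV"

definition gram_matrix :: "('v \<Rightarrow> 'v \<Rightarrow> 'a) \<Rightarrow> 'v list \<Rightarrow> 'a mat" where
  "gram_matrix f vs = mat (length vs) (length vs) (\<lambda>(i, j). f (vs ! i) (vs ! j))"

definition nondegenerate :: "('a::field \<Rightarrow> 'v::ab_group_add \<Rightarrow> 'v) \<Rightarrow> ('v \<Rightarrow> 'v \<Rightarrow> 'a) \<Rightarrow> bool" where
  "nondegenerate scale f \<longleftrightarrow> (\<forall>vs. is_basis scale vs \<longrightarrow> invertible_mat (gram_matrix f vs))"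

definition equivalent_forms ::
  "('a::field \<Rightarrow> 'v::ab_group_add \<Rightarrow> 'v) \<Rightarrow> ('v \<Rightarrow> 'v \<Rightarrow> 'a) \<Rightarrow>
   ('a \<Rightarrow> 'w::ab_group_add \<Rightarrow> 'w) \<Rightarrow> ('w \<Rightarrow> 'w \<Rightarrow> 'a) \<Rightarrow> bool" where
  "equivalent_forms scaleV f scaleW g \<longleftrightarrow>
     (\<exists>x. Vector_Spaces.linear scaleV scaleW x \<and> bij x \<and> (\<forall>u v. g (x u) (x v) = f u v))"

definition orthogonal_sum ::
  "('a::field \<Rightarrow> 'v::ab_group_add \<Rightarrow> 'v) \<Rightarrow> ('v \<Rightarrow> 'v \<Rightarrow> 'a) \<Rightarrow> 'v set \<Rightarrow> 'v set \<Rightarrow> bool" where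
  "orthogonal_sum scale f U1 U2 \<longleftrightarrow>
     module.subspace scale U1 \<and> module.subspace scale U2 \<and>
     U1 \<inter> U2 = {0} \<and> {u + w | u w. u \<in> U1 \<and> w \<in> U2} = UNIV \<and>
     (\<forall>u\<in>U1. \<forall>w\<in>U2. f u w = 0 \<and> f w u = 0)"

definition indecomposable :: "('a::field \<Rightarrow> 'v::ab_group_add \<Rightarrow> 'v) \<Rightarrow> ('v \<Rightarrow> 'v \<Rightarrow> 'a) \<Rightarrow> bool" where
  "indecomposable scale f \<longleftrightarrow>
     (\<forall>U1 U2. orthogonal_sum scale f U1 U2 \<longrightarrow> U1 = {0} \<or> U2 = {0})"

definition GL :: "('a::field \<Rightarrow> 'v::ab_group_add \<Rightarrow> 'v) \<Rightarrow> ('v \<Rightarrow> 'v) set" where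
  "GL scale = {\<sigma>. Vector_Spaces.linear scale scale \<sigma> \<and> bij \<sigma>}"

text \<open>Meaningful for non-degenerate forms on finite-dimensional spaces.\<close>

definition asymmetry ::
  "('a::field \<Rightarrow> 'v::ab_group_add \<Rightarrow> 'v) \<Rightarrow> ('v \<Rightarrow> 'v \<Rightarrow> 'a) \<Rightarrow> ('v \<Rightarrow> 'v)" where
  "asymmetry scale f = (THE \<sigma>. \<sigma> \<in> GL scale \<and> (\<forall>u v. f v u = f u (\<sigma> v)))"

definition similar_maps ::
  "('a::field \<Rightarrow> 'v::ab_group_add \<Rightarrow> 'v) \<Rightarrow> ('v \<Rightarrow> 'v) \<Rightarrow>
   ('a \<Rightarrow> 'w::ab_group_add \<Rightarrow> 'w) \<Rightarrow> ('w \<Rightarrow> 'w) \<Rightarrow> bool" where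
  "similar_maps scaleV \<sigma> scaleW \<tau> \<longleftrightarrow>
     (\<exists>x. Vector_Spaces.linear scaleV scaleW x \<and> bij x \<and> (\<forall>v. x (\<sigma> v) = \<tau> (x v)))"

subsection \<open>Elementary divisors\<close>

text \<open>The action of \<open>F[X]\<close> on \<open>V\<close> in which \<open>X\<close> acts as \<open>\<sigma>\<close>.\<close>

definition poly_action ::
  "('a::field \<Rightarrow> 'v::ab_group_add \<Rightarrow> 'v) \<Rightarrow> ('v \<Rightarrow> 'v) \<Rightarrow> 'a poly \<Rightarrow> 'v \<Rightarrow> 'v" where
  "poly_action scale \<sigma> q v = (\<Sum>i\<le>Polynomial.degree q. scale (Polynomial.coeff q i) ((\<sigma> ^^ i) v))"

definition cyclic_submodule ::
  "('a::field \<Rightarrow> 'v::ab_group_add \<Rightarrow> 'v) \<Rightarrow> ('v \<Rightarrow> 'v) \<Rightarrow> 'v \<Rightarrow> 'v set" where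
  "cyclic_submodule scale \<sigma> w = {poly_action scale \<sigma> q w | q. True}"

definition annihilator ::
  "('a::field \<Rightarrow> 'v::ab_group_add \<Rightarrow> 'v) \<Rightarrow> ('v \<Rightarrow> 'v) \<Rightarrow> 'v \<Rightarrow> 'a poly set" where
  "annihilator scale \<sigma> w = {q. poly_action scale \<sigma> q w = 0}"

text \<open>
  \<open>V\<close> is the internal direct sum of cyclic \<open>F[X]\<close>-submodules \<open>F[X] w\<^sub>i \<cong> F[X]/(q\<^sub>i)\<close>, where the
  \<open>q\<^sub>i\<close> are the members of \<open>E\<close>, each a positive power of a monic irreducible polynomial.
  By the structure theorem the multiset \<open>E\<close> is unique, and it exists when \<open>V\<close> is finite-dimensional.
\<close>

definition has_elementary_divisors ::
  "('a::field \<Rightarrow> 'v::ab_group_add \<Rightarrow> 'v) \<Rightarrow> ('v \<Rightarrow> 'v) \<Rightarrow> 'a poly multiset \<Rightarrow> bool" where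
  "has_elementary_divisors scale \<sigma> E \<longleftrightarrow>
     (\<forall>q\<in>#E. \<exists>p k. Factorial_Ring.irreducible p \<and> Polynomial.lead_coeff p = 1 \<and> k \<ge> 1 \<and> q = p ^ k) \<and>
     (\<exists>qs ws. mset qs = E \<and> length ws = length qs \<and>
        (\<forall>i<length qs. annihilator scale \<sigma> (ws ! i) = {r. qs ! i dvd r}) \<and>
        (\<forall>v. \<exists>!us. length us = length qs \<and>
           (\<forall>i<length qs. us ! i \<in> cyclic_submodule scale \<sigma> (ws ! i)) \<and> v = sum_list us))"

subsection \<open>Separable quadratic extensions\<close>

definition base_ring :: "'a::field ring" where
  "base_ring = \<lparr>carrier = UNIV, monoid.mult = (*), one = 1, ring.zero = 0, add = (+)\<rparr>"

definition poly_eval_ext :: "('k, 'm) ring_scheme \<Rightarrow> ('a::field \<Rightarrow> 'k) \<Rightarrow> 'a poly \<Rightarrow> 'k \<Rightarrow> 'k" where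
  "poly_eval_ext K h q x =
     (\<Oplus>\<^bsub>K\<^esub>i\<in>{..Polynomial.degree q}. h (Polynomial.coeff q i) \<otimes>\<^bsub>K\<^esub> x [^]\<^bsub>K\<^esub> i)"

text \<open>
  \<open>K\<close> is an extension field of \<open>'a\<close>, via the embedding \<open>h\<close>, of degree 2, and every element of
  \<open>K\<close> is separable: its minimal polynomial (up to a scalar, the irreducible polynomial vanishing
  there) is coprime to its own derivative.
\<close>

definition separable_quadratic_extension ::
  "('k, 'm) ring_scheme \<Rightarrow> ('a::field \<Rightarrow> 'k) \<Rightarrow> bool" where
  "separable_quadratic_extension K h \<longleftrightarrow>
     field K \<and> h \<in> Ring.ring_hom base_ring K \<and>
     ring.dimension K 2 (range h) (carrier K) \<and>
     (\<forall>x\<in>carrier K. \<exists>q. Factorial_Ring.irreducible q \<and> coprime q (pderiv q) \<and>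
        poly_eval_ext K h q x = \<zero>\<^bsub>K\<^esub>)"

text \<open>
  A hypothesis cannot quantify over types. It suffices to let \<open>K\<close> range over the fields whose
  carrier is a subset of \<open>'a \<times> 'a\<close>: every field of degree 2 over \<open>'a\<close> is in bijection with
  \<open>'a \<times> 'a\<close> through coordinates in a basis, so it is isomorphic over \<open>'a\<close> to one of these.
\<close>

definition has_separable_quadratic_extension :: "'a::field itself \<Rightarrow> bool" where
  "has_separable_quadratic_extension TYPE('a) \<longleftrightarrow>
     (\<exists>(K :: ('a \<times> 'a) ring) (h :: 'a \<Rightarrow> 'a \<times> 'a). separable_quadratic_extension K h)"

subsection \<open>The forms considered\<close>

definition equal_pair_form ::
  "('a::field \<Rightarrow> 'v::ab_group_add \<Rightarrow> 'v) \<Rightarrow> ('v \<Rightarrow> 'v \<Rightarrow> 'a) \<Rightarrow> 'a \<Rightarrow> nat \<Rightarrow> bool" where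
  "equal_pair_form scale f \<epsilon> m \<longleftrightarrow>
     (\<exists>B. finite_dimensional_vector_space scale B) \<and> (\<exists>v::'v. v \<noteq> 0) \<and>
     bilinear_form scale f \<and> nondegenerate scale f \<and> indecomposable scale f \<and>
     \<epsilon> \<in> {1, -1} \<and> m \<ge> 1 \<and>
     has_elementary_divisors scale (asymmetry scale f) {# [:-\<epsilon>, 1:] ^ m, [:-\<epsilon>, 1:] ^ m #}"

text \<open>The library's \<open>jordan_block\<close> has its ones on the superdiagonal.\<close>

definition lower_jordan_block :: "nat \<Rightarrow> 'a::{zero,one} \<Rightarrow> 'a mat" where
  "lower_jordan_block m a = transpose_mat (jordan_block m a)"

definition normal_form_matrix :: "nat \<Rightarrow> 'a::{zero,one} \<Rightarrow> 'a mat" where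
  "normal_form_matrix m a =
     four_block_mat (0\<^sub>m m m) (transpose_mat (lower_jordan_block m a)) (1\<^sub>m m) (0\<^sub>m m m)"

end

theory Submission
  imports Defs
begin

text \<open>
  Let \<open>N = \<sigma> - \<epsilon>\<close> and \<open>T = \<sigma>\<^sup>-\<^sup>1 - \<epsilon>\<close>; the two are adjoint with respect to \<open>f\<close>.
  The bilinear form \<open>h u v = f u (N ^ (m - 1) v)\<close> is symmetric or skew-symmetric, and a vector with
  \<open>h u u \<noteq> 0\<close> generates a non-degenerate cyclic submodule that splits off; hence \<open>h\<close> is
  alternating when \<open>f\<close> is indecomposable. Starting from \<open>u, w\<close> with \<open>h u w \<noteq> 0\<close>, one makes
  \<open>f u (N ^ k u)\<close> vanish for \<open>k = m - 1, m - 2, \<dots>, 0\<close> in turn, replacing \<open>u\<close> by \<open>u + a N ^ l w\<close>.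
  In characteristic not 2 the condition on \<open>a\<close> is linear with leading coefficient \<open>2 h u w\<close>
  (\<open>l = m - 1 - k\<close>). In characteristic 2 odd \<open>k\<close> need no change, and for even \<open>k\<close> the choice
  \<open>l = m - 2 - k\<close> gives a linear condition again, except that for \<open>l = 0\<close> it is an Artin--Schreier
  equation \<open>t\<^sup>2 + t + c = 0\<close>, solvable because otherwise its splitting field would be a separable
  quadratic extension. Doing this for \<open>u\<close> and then for \<open>w\<close> yields two complementary totally
  isotropic cyclic submodules; dual bases of these give the Gram matrix.
\<close>

subsection \<open>Unipotent isometries up to sign\<close>

text \<open>The assumption \<open>T_eq\<close> is \<open>(N + \<epsilon>)(T + \<epsilon>) = 1\<close>, that is, \<open>\<sigma> \<sigma>\<^sup>-\<^sup>1 = 1\<close>.\<close>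

locale unipotent_isometry = vector_space scale
  for scale :: "'a::field \<Rightarrow> 'v::ab_group_add \<Rightarrow> 'v" +
  fixes f :: "'v \<Rightarrow> 'v \<Rightarrow> 'a" and N T :: "'v \<Rightarrow> 'v" and \<epsilon> :: 'a and m :: nat
  assumes bilinear: "bilinear_form scale f"
    and N_linear: "Vector_Spaces.linear scale scale N"
    and T_linear: "Vector_Spaces.linear scale scale T"
    and eps_square: "\<epsilon> * \<epsilon> = 1"
    and swap: "f v u = f u (N v) + \<epsilon> * f u v"
    and adjoint_N: "f (N u) v = f u (T v)"
    and T_eq: "T v = - N v - scale \<epsilon> (T (N v))"
    and N_T_commute: "N (T v) = T (N v)"
    and nilpotent: "(N ^^ m) v = 0"
    and m_pos: "m \<ge> 1"
begin

section \<open>Linearity rules, and adjointness of the powers of \<open>N\<close> and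
  \<open>T\<close>\<close>

lemma form_add [simp]: "f u (v + w) = f u v + f u w" "f (v + w) u = f v u + f w u"
  and form_scale [simp]: "f u (scale a v) = a * f u v" "f (scale a v) u = a * f v u"
  using bilinear unfolding bilinear_form_def Vector_Spaces.linear_iff by auto

lemma form_zero [simp]: "f u 0 = 0" "f 0 u = 0"
  using form_scale(1)[of u 0] form_scale(2)[of 0 _ u] by auto

lemma form_minus [simp]: "f u (- v) = - f u v" "f (- v) u = - f v u"
  using form_add(1)[of u v "- v"] form_add(2)[of v "- v" u] by (auto simp: eq_neg_iff_add_eq_0 add.commute)

lemma form_diff [simp]: "f u (v - w) = f u v - f u w" "f (v - w) u = f v u - f w u"
  using form_add(1)[of u v "- w"] form_add(2)[of v "- w" u] by auto

lemma N_add [simp]: "N (u + v) = N u + N v" and N_scale [simp]: "N (scale a v) = scale a (N v)"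
  using N_linear unfolding Vector_Spaces.linear_iff by auto

lemma T_add [simp]: "T (u + v) = T u + T v" and T_scale [simp]: "T (scale a v) = scale a (T v)"
  using T_linear unfolding Vector_Spaces.linear_iff by auto

lemma N_zero [simp]: "N 0 = 0" and T_zero [simp]: "T 0 = 0"
  using N_scale[of 0] T_scale[of 0] by auto

lemma N_pow_add [simp]: "(N ^^ i) (u + v) = (N ^^ i) u + (N ^^ i) v"
  and N_pow_scale [simp]: "(N ^^ i) (scale a v) = scale a ((N ^^ i) v)"
  and N_pow_zero [simp]: "(N ^^ i) 0 = 0"
  by (induction i) auto

lemma T_pow_add [simp]: "(T ^^ i) (u + v) = (T ^^ i) u + (T ^^ i) v"
  and T_pow_scale [simp]: "(T ^^ i) (scale a v) = scale a ((T ^^ i) v)"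
  and T_pow_zero [simp]: "(T ^^ i) 0 = 0"
  by (induction i) auto

lemma T_neg [simp]: "T (- u) = - T u" and T_diff [simp]: "T (u - v) = T u - T v"
  using T_scale[of "-1" u] T_add[of u "- v"] T_scale[of "-1" v] by auto

lemma T_pow_neg [simp]: "(T ^^ i) (- u) = - (T ^^ i) u"
  by (induction i) auto

lemma T_pow_diff [simp]: "(T ^^ i) (u - v) = (T ^^ i) u - (T ^^ i) v"
  using T_pow_add[of i u "- v"] by (simp del: T_pow_add)

lemma N_neg [simp]: "N (- u) = - N u" and N_diff [simp]: "N (u - v) = N u - N v"
  using N_scale[of "-1" u] N_add[of u "- v"] N_scale[of "-1" v] by auto

lemma N_pow_neg [simp]: "(N ^^ i) (- u) = - (N ^^ i) u"
  by (induction i) auto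

lemma N_pow_diff [simp]: "(N ^^ i) (u - v) = (N ^^ i) u - (N ^^ i) v"
  using N_pow_add[of i u "- v"] by (simp del: N_pow_add)

lemma N_pow_ge: "i \<ge> m \<Longrightarrow> (N ^^ i) v = 0"
  using nilpotent[of "(N ^^ (i - m)) v"] funpow_add[of m "i - m" N] by auto

lemma N_pow_N_pow: "(N ^^ i) ((N ^^ j) v) = (N ^^ (i + j)) v"
  by (simp add: funpow_add)

lemma adjoint_N_pow: "f ((N ^^ i) u) v = f u ((T ^^ i) v)"
  by (induction i arbitrary: u v) (auto simp: adjoint_N funpow_swap1)

text \<open>Two uses of \<open>swap\<close> exchange the arguments and exchange them back; in
  between, \<open>adjoint_N\<close> read from right to left takes \<open>T\<close> off one argument
  and puts \<open>N\<close> on the other.\<close>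

lemma adjoint_T: "f (T u) v = f u (N v)"
proof -
  have "f (T u) v = f v (N (T u)) + \<epsilon> * f v (T u)" by (rule swap)
  also have "\<dots> = f (N v) (N u) + \<epsilon> * f (N v) u"
    by (simp add: adjoint_N N_T_commute)
  also have "\<dots> = f u (N v)" using swap[of u "N v"] by simp
  finally show ?thesis .
qed

lemma adjoint_T_pow: "f ((T ^^ i) u) v = f u ((N ^^ i) v)"
  by (induction i arbitrary: u v) (auto simp: adjoint_T funpow_swap1)

section \<open>The descending chain N^j F[N] u in the cyclic submodule generated by u\<close>

definition orbit_span :: "nat \<Rightarrow> 'v \<Rightarrow> 'v set" where
  "orbit_span j u = span {(N ^^ i) u | i. i \<ge> j}"

lemma N_pow_in_orbit_span: "i \<ge> j \<Longrightarrow> (N ^^ i) u \<in> orbit_span j u"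
  unfolding orbit_span_def by (auto intro: span_base)

lemma self_in_orbit_span: "u \<in> orbit_span 0 u"
  using N_pow_in_orbit_span[of 0 0 u] by simp

lemma orbit_span_induct [consumes 1, case_names pow add scale]:
  assumes "x \<in> orbit_span j u"
    and "\<And>i. i \<ge> j \<Longrightarrow> P ((N ^^ i) u)"
    and "\<And>x y. P x \<Longrightarrow> P y \<Longrightarrow> P (x + y)"
    and "\<And>a x. P x \<Longrightarrow> P (scale a x)"
  shows "P x"
proof -
  have "P 0" using assms(4)[OF assms(2)[of j], of 0] by simp
  then have "subspace {x. P x}" using assms(3,4) by (intro subspaceI) auto
  then show ?thesis
    using assms(1) span_minimal[of "{(N ^^ i) u | i. i \<ge> j}" "{x. P x}"] assms(2)
    unfolding orbit_span_def by auto
qed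

lemma orbit_span_subspace: "subspace (orbit_span j u)"
  unfolding orbit_span_def by simp

lemmas orbit_span_add = subspace_add[OF orbit_span_subspace]
lemmas orbit_span_scale = subspace_scale[OF orbit_span_subspace]
lemmas orbit_span_diff = subspace_diff[OF orbit_span_subspace]
lemmas orbit_span_neg = subspace_neg[OF orbit_span_subspace]

lemma N_orbit_span: "x \<in> orbit_span j u \<Longrightarrow> N x \<in> orbit_span (Suc j) u"
proof (induction rule: orbit_span_induct)
  case (pow i)
  then show ?case using N_pow_in_orbit_span[of "Suc j" "Suc i"] by simp
qed (auto intro: orbit_span_add orbit_span_scale)

lemma orbit_span_antimono: "j \<le> k \<Longrightarrow> orbit_span k u \<subseteq> orbit_span j u"
  unfolding orbit_span_def by (intro span_mono) auto

lemma N_pow_orbit_span: "x \<in> orbit_span j u \<Longrightarrow> (N ^^ i) x \<in> orbit_span (i + j) u"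
  by (induction i) (auto intro: N_orbit_span)

text \<open>The recursion \<open>T_eq\<close> trades \<open>T\<close> for \<open>N\<close> and
  \<open>T N\<close>, both of which raise the exponent. Nilpotency ends it, so the induction runs
  downwards from \<open>m\<close>. In effect \<open>T\<close> is a polynomial in \<open>N\<close>
  without constant term.\<close>

lemma T_N_pow_in_orbit_span: "T ((N ^^ i) u) \<in> orbit_span (Suc i) u"
proof (induction "m - i" arbitrary: i)
  case 0
  then have "(N ^^ i) u = 0" by (simp add: N_pow_ge)
  then show ?case using subspace_0[OF orbit_span_subspace] by simp
next
  case (Suc d)
  have "T ((N ^^ Suc i) u) \<in> orbit_span (Suc (Suc i)) u"
    using Suc.hyps(1)[of "Suc i"] Suc.hyps(2) by simp
  then have "T (N ((N ^^ i) u)) \<in> orbit_span (Suc i) u"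
    using orbit_span_antimono[of "Suc i" "Suc (Suc i)"] by auto
  moreover have "N ((N ^^ i) u) \<in> orbit_span (Suc i) u"
    using N_pow_in_orbit_span[of "Suc i" "Suc i"] by simp
  ultimately show ?case
    unfolding T_eq[of "(N ^^ i) u"] by (intro orbit_span_diff orbit_span_scale orbit_span_neg)
qed

lemma T_orbit_span: "x \<in> orbit_span j u \<Longrightarrow> T x \<in> orbit_span (Suc j) u"
proof (induction rule: orbit_span_induct)
  case (pow i)
  then show ?case using T_N_pow_in_orbit_span[of i] orbit_span_antimono[of "Suc j" "Suc i"] by auto
qed (auto intro: orbit_span_add orbit_span_scale)

lemma T_pow_orbit_span: "x \<in> orbit_span j u \<Longrightarrow> (T ^^ i) x \<in> orbit_span (i + j) u"
  by (induction i) (auto intro: T_orbit_span)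

lemma form_orbit_span_eq_0:
  assumes "x \<in> orbit_span j z" "\<And>i. i \<ge> j \<Longrightarrow> f u ((N ^^ i) z) = 0"
  shows "f u x = 0"
  using assms(1) by (induction rule: orbit_span_induct) (auto simp: assms(2))

text \<open>Serves to climb the chain: an element whose coefficient \<open>b\<close> vanishes lies
  one level deeper.\<close>

lemma orbit_span_leading:
  assumes "x \<in> orbit_span j u"
  shows "\<exists>b. x - scale b ((N ^^ j) u) \<in> orbit_span (Suc j) u"
  using assms
proof (induction rule: orbit_span_induct)
  case (pow i)
  show ?case
  proof (cases "i = j")
    case True
    then show ?thesis using subspace_0[OF orbit_span_subspace] by (intro exI[of _ 1]) simp
  next
    case False
    then show ?thesis using pow N_pow_in_orbit_span[of "Suc j" i u] by (intro exI[of _ 0]) simp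
  qed
next
  case (add x y)
  then obtain b c where "x - scale b ((N ^^ j) u) \<in> orbit_span (Suc j) u"
    "y - scale c ((N ^^ j) u) \<in> orbit_span (Suc j) u" by auto
  from orbit_span_add[OF this] show ?case
    by (intro exI[of _ "b + c"]) (simp add: algebra_simps)
next
  case (scale a x)
  then obtain b where "x - scale b ((N ^^ j) u) \<in> orbit_span (Suc j) u" by auto
  from orbit_span_scale[OF this, of a] show ?case
    by (intro exI[of _ "a * b"]) (simp add: algebra_simps)
qed

section \<open>Pairings with powers of \<open>T\<close> in terms of powers of
  \<open>N\<close>\<close>

lemma form_T_pow_eq_0:
  assumes "\<And>i. i \<ge> j \<Longrightarrow> f u ((N ^^ i) z) = 0"
  shows "f u ((T ^^ j) z) = 0"
  using form_orbit_span_eq_0[OF T_pow_orbit_span[OF self_in_orbit_span, of j z]] assms by auto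

text \<open>By \<open>T_eq\<close>, \<open>T\<close> is \<open>- N\<close> up to terms of higher
  order in \<open>N\<close>; so \<open>T ^^ j\<close> is \<open>(- 1) ^ j\<close> times
  \<open>N ^^ j\<close> up to powers above \<open>j\<close>, which the assumption
  annihilates.\<close>

lemma form_T_pow:
  assumes "\<And>i. i > j \<Longrightarrow> f u ((N ^^ i) z) = 0"
  shows "f u ((T ^^ j) z) = (- 1) ^ j * f u ((N ^^ j) z)"
  using assms
proof (induction j arbitrary: z)
  case (Suc j)
  have 1: "f u ((T ^^ j) (N z)) = (- 1) ^ j * f u ((N ^^ j) (N z))"
    by (rule Suc.IH) (use Suc.prems[of "Suc i" for i] in \<open>simp add: funpow_swap1\<close>)
  have 2: "f u ((T ^^ Suc j) (N z)) = 0"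
    by (rule form_T_pow_eq_0) (use Suc.prems[of "Suc i" for i] in \<open>simp add: funpow_swap1\<close>)
  have "(T ^^ Suc j) z = (T ^^ j) (T z)" by (simp add: funpow_swap1)
  also have "\<dots> = - (T ^^ j) (N z) - scale \<epsilon> ((T ^^ Suc j) (N z))"
    by (subst T_eq) (simp add: funpow_swap1)
  finally show ?case using 1 2 by (simp add: funpow_swap1)
qed auto

text \<open>
  Even powers of \<open>T\<close> agree with those of \<open>N\<close> to one order more than in \<open>form_T_pow\<close>,
  because \<open>T\<^sup>2 = N\<^sup>2 + N\<^sup>2 T\<^sup>2\<close> in characteristic 2.
\<close>

lemma form_T_pow_double:
  assumes "(2::'a) = 0" "\<epsilon> = 1" "\<And>i. i > 2 * s + 1 \<Longrightarrow> f u ((N ^^ i) z) = 0"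
  shows "f u ((T ^^ (2 * s)) z) = f u ((N ^^ (2 * s)) z)"
  using assms(3)
proof (induction s arbitrary: z)
  case (Suc s)
  have minus [simp]: "- a = a" for a :: 'v
  proof -
    have "a + a = scale 2 a" using scale_left_distrib[of 1 1 a] by simp
    then show ?thesis using assms(1) by (simp add: eq_neg_iff_add_eq_0[symmetric])
  qed
  have T: "T x = N x + T (N x)" for x
    using T_eq[of x] assms(2) minus[of "T (N x)"] minus[of "N x"] by (metis diff_conv_add_uminus scale_one)
  have cancel: "a + (b + (b + c)) = a + c" for a b c :: 'v
    using minus[of b] by (metis add.assoc add.left_inverse add.left_neutral)
  have TT: "T (T x) = N (N x) + T (T (N (N x)))" for x
  proof -
    have "T (T x) = T (N x) + T (N (T x))" by (subst T) (simp add: N_T_commute)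
    also have "\<dots> = T (N x) + T (N (N x) + T (N (N x)))"
      by (subst (2) T) (simp add: N_T_commute)
    also have "T (N x) = N (N x) + T (N (N x))" by (rule T)
    finally show ?thesis by (simp add: add.assoc cancel)
  qed
  have Npow: "(N ^^ i) (N (N z)) = (N ^^ (i + 2)) z" for i
    using N_pow_N_pow[of i 2 z] by (simp add: numeral_2_eq_2)
  have IH: "f u ((T ^^ (2 * s)) (N (N z))) = f u ((N ^^ (2 * s)) (N (N z)))"
    by (rule Suc.IH) (use Suc.prems[of "i + 2" for i] in \<open>simp add: Npow\<close>)
  have 2: "f u ((T ^^ (2 * s + 2)) (N (N z))) = 0"
    by (rule form_T_pow_eq_0) (use Suc.prems[of "i + 2" for i] in \<open>simp add: Npow\<close>)
  have e: "2 * Suc s = 2 * s + 2" by simp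
  have sw: "(T ^^ (2 * s + 2)) x = (T ^^ (2 * s)) (T (T x))" for x
  proof -
    have "(T ^^ 2) x = T (T x)" by (simp add: numeral_2_eq_2)
    then show ?thesis by (simp only: funpow_add o_apply)
  qed
  have "(T ^^ (2 * Suc s)) z = (T ^^ (2 * s)) (N (N z)) + (T ^^ (2 * s + 2)) (N (N z))"
    unfolding e sw by (subst TT) simp
  then show ?case using IH 2 unfolding e by (simp add: Npow)
qed auto

text \<open>Powers of \<open>N\<close> on the left become powers of \<open>T\<close> on the right,
  which keep the right argument in the cyclic submodule; so only pairings with \<open>u\<close>
  itself on the left matter.\<close>

lemma orbit_span_isotropic:
  assumes "\<And>i. f u ((N ^^ i) u) = 0" "x \<in> orbit_span 0 u" "y \<in> orbit_span 0 u"
  shows "f x y = 0"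
proof -
  have *: "f u y = 0" if "y \<in> orbit_span 0 u" for y
    by (rule form_orbit_span_eq_0[OF that]) (simp add: assms(1))
  show ?thesis using assms(2)
  proof (induction rule: orbit_span_induct)
    case (pow i)
    have "(T ^^ i) y \<in> orbit_span 0 u"
      using T_pow_orbit_span[OF assms(3), of i] orbit_span_antimono[of 0 i] by auto
    then show ?case using * by (simp add: adjoint_N_pow)
  qed auto
qed

text \<open>A triangular linear system, solved for \<open>i = m - 1, m - 2, ...\<close> in turn: the
  equation of index \<open>m - 1 - d\<close> by adding a multiple of \<open>(N ^^ d) u\<close>. The
  diagonal coefficient is the nonzero top pairing, and nilpotency leaves the equations of larger
  index undisturbed.\<close>

lemma orbit_span_solve:
  assumes "f w ((N ^^ (m - 1)) u) \<noteq> 0"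
  obtains x where "x \<in> orbit_span 0 u" "\<And>i. i < m \<Longrightarrow> f w ((N ^^ i) x) = c i"
proof -
  have "\<exists>x\<in>orbit_span 0 u. \<forall>i<m. i + d \<ge> m \<longrightarrow> f w ((N ^^ i) x) = c i" for d
  proof (induction d)
    case 0
    then show ?case using self_in_orbit_span by auto
  next
    case (Suc d)
    then obtain x where x: "x \<in> orbit_span 0 u" "\<And>i. i < m \<Longrightarrow> i + d \<ge> m \<Longrightarrow> f w ((N ^^ i) x) = c i"
      by auto
    show ?case
    proof (cases "d < m")
      case False
      then show ?thesis using x by auto
    next
      case True
      define k where "k = m - Suc d"
      define a where "a = (c k - f w ((N ^^ k) x)) / f w ((N ^^ (m - 1)) u)"
      define y where "y = x + scale a ((N ^^ d) u)"
      have "y \<in> orbit_span 0 u"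
        unfolding y_def by (intro orbit_span_add orbit_span_scale x N_pow_in_orbit_span) auto
      moreover have "f w ((N ^^ i) y) = c i" if "i < m" "i + Suc d \<ge> m" for i
      proof (cases "i = k")
        case True
        then have "i + d = m - 1" using \<open>d < m\<close> unfolding k_def by auto
        then show ?thesis using assms True unfolding y_def
          by (simp add: N_pow_N_pow a_def)
      next
        case False
        then have "i + d \<ge> m" using that \<open>d < m\<close> unfolding k_def by auto
        then show ?thesis using x(2)[of i] that unfolding y_def by (simp add: N_pow_N_pow N_pow_ge)
      qed
      ultimately show ?thesis by blast
    qed
  qed
  from this[of m] show ?thesis using that by auto
qed

section \<open>The form \<open>h\<close> of the opening comment, and the splitting off of cyclic
  summands\<close>

definition top_form :: "'v \<Rightarrow> 'v \<Rightarrow> 'a" where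
  "top_form u v = f u ((N ^^ (m - 1)) v)"

text \<open>The term with \<open>N v\<close> coming from \<open>swap\<close> has order
  \<open>m\<close> and vanishes. In the other term \<open>T ^^ (m - 1)\<close> may be replaced by
  \<open>(- 1) ^ (m - 1)\<close> times \<open>N ^^ (m - 1)\<close>, since all higher powers are
  zero.\<close>

lemma top_form_swap: "top_form v u = (- 1) ^ (m - 1) * \<epsilon> * top_form u v"
proof -
  have N: "(N ^^ i) (N v) = 0" if "i \<ge> m - 1" for i
  proof -
    have "(N ^^ Suc i) v = 0" using that by (intro N_pow_ge) linarith
    then show ?thesis by (simp add: funpow_swap1)
  qed
  have "top_form v u = f ((N ^^ (m - 1)) u) (N v) + \<epsilon> * f ((N ^^ (m - 1)) u) v"
    unfolding top_form_def by (rule swap)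
  also have "f ((N ^^ (m - 1)) u) (N v) = 0"
    unfolding adjoint_N_pow by (rule form_T_pow_eq_0) (simp add: N)
  also have "f ((N ^^ (m - 1)) u) v = (- 1) ^ (m - 1) * f u ((N ^^ (m - 1)) v)"
    unfolding adjoint_N_pow by (rule form_T_pow) (simp add: N_pow_ge)
  finally show ?thesis unfolding top_form_def by (simp add: ac_simps)
qed

text \<open>Triangularity gives both halves: \<open>orbit_span_solve\<close> yields the component in
  the cyclic submodule, and a vector in the intersection is pushed along the chain to level
  \<open>m\<close>, which is zero. Invariance under \<open>T\<close> makes the right orthogonal a
  left orthogonal too.\<close>

lemma orbit_span_complement:
  assumes "top_form u u \<noteq> 0"
  shows "orthogonal_sum scale f (orbit_span 0 u) {y. \<forall>x\<in>orbit_span 0 u. f x y = 0}"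
proof -
  let ?U = "orbit_span 0 u" and ?W = "{y. \<forall>x\<in>orbit_span 0 u. f x y = 0}"
  have top: "f u ((N ^^ (m - 1)) u) \<noteq> 0" using assms unfolding top_form_def .
  have W: "y \<in> ?W" if "\<And>i. f u ((N ^^ i) y) = 0" for y
  proof -
    have "f x y = 0" if "x \<in> ?U" for x
    proof -
      have u0: "f u z = 0" if "z \<in> orbit_span 0 y" for z
        by (rule form_orbit_span_eq_0[OF that]) (simp add: \<open>\<And>i. f u ((N ^^ i) y) = 0\<close>)
      show ?thesis using that
      proof (induction rule: orbit_span_induct)
        case (pow i)
        have "(T ^^ i) y \<in> orbit_span 0 y"
          using T_pow_orbit_span[OF self_in_orbit_span, of i y] orbit_span_antimono[of 0 i] by auto
        then show ?case using u0 by (simp add: adjoint_N_pow)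
      qed auto
    qed
    then show ?thesis by auto
  qed
  have "\<exists>x y. v = x + y \<and> x \<in> ?U \<and> y \<in> ?W" for v
  proof -
    obtain x where x: "x \<in> ?U" "\<And>i. i < m \<Longrightarrow> f u ((N ^^ i) x) = f u ((N ^^ i) v)"
      using orbit_span_solve[OF top, of "\<lambda>i. f u ((N ^^ i) v)"] by blast
    have "f u ((N ^^ i) (v - x)) = 0" for i
    proof -
      have "f u ((N ^^ i) x) = f u ((N ^^ i) v)"
        using x(2) N_pow_ge[of i] by (cases "i < m") auto
      then show ?thesis by simp
    qed
    from W[OF this] show ?thesis using x(1) by (intro exI[of _ x] exI[of _ "v - x"] conjI) simp_all
  qed
  then have sum: "{x + y | x y. x \<in> ?U \<and> y \<in> ?W} = UNIV"
    unfolding set_eq_iff mem_Collect_eq by simp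
  have perp: "f x y = 0 \<and> f y x = 0" if "x \<in> ?U" "y \<in> ?W" for x y
  proof
    show "f x y = 0" using that by auto
    have "f y x = f (T x) y + \<epsilon> * f x y"
      using swap[of y x] by (simp add: adjoint_T)
    moreover have "T x \<in> ?U" using T_orbit_span[OF that(1)] orbit_span_antimono[of 0 1] by auto
    ultimately show "f y x = 0" using that by auto
  qed
  have "x = 0" if x: "x \<in> ?U" "x \<in> ?W" for x
  proof -
    have "x \<in> orbit_span d u" for d
    proof (induction d)
      case (Suc d)
      obtain b where b: "x - scale b ((N ^^ d) u) \<in> orbit_span (Suc d) u"
        using orbit_span_leading[OF Suc] by auto
      show ?case
      proof (cases "d < m")
        case False
        then show ?thesis using b by (simp add: N_pow_ge)
      next
        case True
        \<comment> \<open>Pairing \<open>u\<close> with \<open>N ^^ (m - 1 - d)\<close> isolates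
          \<open>b\<close>: the remainder \<open>y\<close> acquires order \<open>m\<close>, while
          the leading term gets the exponent \<open>m - 1\<close> exactly.\<close>
        define y where "y = x - scale b ((N ^^ d) u)"
        have "f u ((N ^^ (m - 1 - d)) y) = 0"
        proof (rule form_orbit_span_eq_0)
          show "(N ^^ (m - 1 - d)) y \<in> orbit_span (m - 1 - d + Suc d) u"
            using b unfolding y_def by (rule N_pow_orbit_span)
          show "f u ((N ^^ i) u) = 0" if "i \<ge> m - 1 - d + Suc d" for i
          proof -
            have "i \<ge> m" using that True by linarith
            then show ?thesis by (simp add: N_pow_ge)
          qed
        qed
        moreover have "f u ((N ^^ (m - 1 - d)) x) = 0"
        proof -
          have "(T ^^ (m - 1 - d)) u \<in> ?U"
            using T_pow_orbit_span[OF self_in_orbit_span, of "m - 1 - d" u]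
              orbit_span_antimono[of 0 "m - 1 - d"] by auto
          then have "f ((T ^^ (m - 1 - d)) u) x = 0" using x(2) by blast
          then show ?thesis by (simp only: adjoint_T_pow)
        qed
        moreover have "(N ^^ (m - 1 - d)) x = (N ^^ (m - 1 - d)) y + scale b ((N ^^ (m - 1)) u)"
        proof -
          have "m - 1 - d + d = m - 1" using True by linarith
          then show ?thesis unfolding y_def by (simp add: N_pow_N_pow)
        qed
        ultimately have "b = 0" using top by simp
        then show ?thesis using b by simp
      qed
    qed (rule x(1))
    from this[of m] have "x \<in> orbit_span m u" .
    then show ?thesis by (induction rule: orbit_span_induct) (auto simp: N_pow_ge)
  qed
  then have int: "?U \<inter> ?W = {0}"
    using subspace_0[OF orbit_span_subspace, of 0 u] by fastforce
  have W_subspace: "subspace ?W" by (intro subspaceI) simp_all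
  show ?thesis
    unfolding orthogonal_sum_def
    by (intro conjI ballI orbit_span_subspace W_subspace sum int; use perp in blast)
qed

section \<open>Correcting a vector so that its self-pairings vanish\<close>

lemma self_form_shift:
  fixes a :: 'a and l :: nat and u w :: 'v
  defines "u' \<equiv> u + scale a ((N ^^ l) w)"
  shows "f u' ((N ^^ j) u') = f u ((N ^^ j) u)
    + a * (f u ((N ^^ (j + l)) w) + f u ((T ^^ j) ((N ^^ Suc l) w)) + \<epsilon> * f u ((T ^^ j) ((N ^^ l) w)))
    + a * a * f w ((T ^^ l) ((N ^^ (j + l)) w))"
proof -
  \<comment> \<open>The cross term with \<open>u\<close> on the right is turned around by
    \<open>swap\<close>; it supplies two of the three terms in the coefficient of
    \<open>a\<close>.\<close>
  have "f ((N ^^ l) w) ((N ^^ j) u) = f u ((T ^^ j) (N ((N ^^ l) w))) + \<epsilon> * f u ((T ^^ j) ((N ^^ l) w))"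
    using swap[of "(N ^^ l) w" "(N ^^ j) u"] by (simp add: adjoint_N_pow)
  moreover have "f ((N ^^ l) w) ((N ^^ (j + l)) w) = f w ((T ^^ l) ((N ^^ (j + l)) w))"
    by (simp add: adjoint_N_pow)
  ultimately show ?thesis
    unfolding u'_def by (simp add: N_pow_N_pow algebra_simps)
qed

text \<open>A constraint among the self-pairings of one vector. It decides which \<open>k\<close>
  may need a correction: those with \<open>\<epsilon> * (- 1) ^ k = 1\<close> outside characteristic
  2, and even \<open>k\<close> in characteristic 2.\<close>

lemma self_form_swap:
  "f u ((N ^^ k) u) = f u ((T ^^ k) (N u)) + \<epsilon> * f u ((T ^^ k) u)"
  using swap[of u "(N ^^ k) u"] by (simp add: adjoint_N_pow)

lemma form_T_pow_N:
  assumes "\<And>i. i > k \<Longrightarrow> f u ((N ^^ i) z) = 0"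
  shows "f u ((T ^^ k) (N z)) = 0"
proof (rule form_T_pow_eq_0)
  fix i assume "i \<ge> k"
  then show "f u ((N ^^ i) (N z)) = 0" using assms[of "Suc i"] by (simp add: funpow_swap1)
qed

text \<open>The added term is a multiple of \<open>top_form w w\<close> for \<open>l = 0\<close>,
  zero by alternation, and has order at least \<open>m\<close> for \<open>l > 0\<close>.\<close>

lemma top_form_shift:
  assumes "\<And>v. top_form v v = 0"
  shows "top_form (u + scale a ((N ^^ l) w)) w = top_form u w"
proof -
  have "f ((N ^^ l) w) ((N ^^ (m - 1)) w) = 0"
  proof (cases "l = 0")
    case True
    then show ?thesis using assms[of w] unfolding top_form_def by simp
  next
    case False
    have "f w ((T ^^ l) ((N ^^ (m - 1)) w)) = 0"
    proof (rule form_T_pow_eq_0)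
      fix i assume "i \<ge> l"
      then have "i + (m - 1) \<ge> m" using False by linarith
      then show "f w ((N ^^ i) ((N ^^ (m - 1)) w)) = 0" by (simp add: N_pow_N_pow N_pow_ge)
    qed
    then show ?thesis by (simp add: adjoint_N_pow)
  qed
  then show ?thesis unfolding top_form_def by simp
qed

text \<open>The exponent \<open>l = m - 1 - k\<close> is at least 1, so the quadratic term has order
  \<open>j + 2 * l \<ge> m\<close> and drops out. For \<open>j > k\<close> the linear terms drop out
  as well, which preserves \<open>good\<close> and leaves one equation, at
  \<open>j = k\<close>.\<close>

lemma isotropic_step_not_2:
  assumes two: "(2::'a) \<noteq> 0" and alt: "\<And>v. top_form v v = 0" and top: "top_form u w \<noteq> 0"
    and good: "\<And>i. i > k \<Longrightarrow> f u ((N ^^ i) u) = 0"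
  shows "\<exists>u'. top_form u' w \<noteq> 0 \<and> (\<forall>i\<ge>k. f u' ((N ^^ i) u') = 0)"
proof (cases "f u ((N ^^ k) u) = 0")
  case True
  then show ?thesis using good top by (metis le_neq_implies_less)
next
  case False
  have "k < m - 1"
  proof (rule ccontr)
    assume "\<not> k < m - 1"
    then have "k = m - 1 \<or> k \<ge> m" by linarith
    then show False using False alt[of u] N_pow_ge[of k u] unfolding top_form_def by auto
  qed
  \<comment> \<open>A nonzero self-pairing forces this sign to be 1; with the opposite sign the two
    contributions to the linear coefficient would cancel.\<close>
  have "f u ((N ^^ k) u) = \<epsilon> * (- 1) ^ k * f u ((N ^^ k) u)"
    using self_form_swap[of u k] form_T_pow_N[of k u u] form_T_pow[of k u u] good by simp
  then have sign: "\<epsilon> * (- 1) ^ k = 1" using False by simp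
  \<comment> \<open>Now \<open>k + l = m - 1\<close>, so the linear terms are top pairings, and
    \<open>a\<close> solves \<open>f u ((N ^^ k) u) + 2 * a * top_form u w = 0\<close>.\<close>
  define l where "l = m - 1 - k"
  define a where "a = - f u ((N ^^ k) u) / (2 * top_form u w)"
  define u' where "u' = u + scale a ((N ^^ l) w)"
  have "f u' ((N ^^ j) u') = 0" if "j \<ge> k" for j
  proof -
    have N: "(N ^^ i) ((N ^^ l) w) = 0" if "i > k" for i
    proof -
      have "i + l \<ge> m" using that \<open>k < m - 1\<close> unfolding l_def by linarith
      then show ?thesis by (simp add: N_pow_N_pow N_pow_ge)
    qed
    have 1: "f u ((T ^^ j) ((N ^^ Suc l) w)) = 0"
      using form_T_pow_N[of j u "(N ^^ l) w"] N that by simp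
    have "f w ((T ^^ l) ((N ^^ (j + l)) w)) = 0"
    proof (rule form_T_pow_eq_0)
      fix i assume "i \<ge> l"
      then have "i + (j + l) \<ge> m" using that \<open>k < m - 1\<close> unfolding l_def by linarith
      then show "f w ((N ^^ i) ((N ^^ (j + l)) w)) = 0" by (simp add: N_pow_N_pow N_pow_ge)
    qed
    then have *: "f u' ((N ^^ j) u') = f u ((N ^^ j) u)
        + a * (f u ((N ^^ (j + l)) w) + \<epsilon> * f u ((T ^^ j) ((N ^^ l) w)))"
      unfolding u'_def self_form_shift using 1 by simp
    show ?thesis
    proof (cases "j = k")
      case True
      have "j + l = m - 1" using True \<open>k < m - 1\<close> unfolding l_def by linarith
      moreover have "f u ((T ^^ j) ((N ^^ l) w)) = (- 1) ^ k * f u ((N ^^ (j + l)) w)"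
        using form_T_pow[of k u "(N ^^ l) w"] N True by (simp add: N_pow_N_pow)
      ultimately have "f u' ((N ^^ j) u') = f u ((N ^^ k) u) + a * (top_form u w + \<epsilon> * (- 1) ^ k * top_form u w)"
        using * unfolding True top_form_def by (simp add: mult.assoc)
      then show ?thesis using top two unfolding sign a_def by (simp add: field_simps)
    next
      case False
      then have "j > k" using that by simp
      then have "f u ((T ^^ j) ((N ^^ l) w)) = 0"
        by (intro form_T_pow_eq_0) (simp add: N)
      then show ?thesis using good[OF \<open>j > k\<close>] N[OF \<open>j > k\<close>] unfolding * by (simp add: N_pow_N_pow)
    qed
  qed
  moreover have "top_form u' w \<noteq> 0" using top_form_shift[OF alt] top unfolding u'_def by simp
  ultimately show ?thesis by blast
qed

lemma isotropic_step_2: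
  assumes two: "(2::'a) = 0" and quadratic: "\<And>c::'a. \<exists>t. t * t + t + c = 0"
    and alt: "\<And>v. top_form v v = 0" and top: "top_form u w \<noteq> 0"
    and good: "\<And>i. i > k \<Longrightarrow> f u ((N ^^ i) u) = 0"
  shows "\<exists>u'. top_form u' w \<noteq> 0 \<and> (\<forall>i\<ge>k. f u' ((N ^^ i) u') = 0)"
proof (cases "f u ((N ^^ k) u) = 0")
  case True
  then show ?thesis using good top by (metis le_neq_implies_less)
next
  case False
  have double: "x + x = 0" for x :: 'a using two by (metis mult_2 mult_zero_left)
  have minus: "- x = x" for x :: 'a using double[of x] by (rule minus_unique)
  \<comment> \<open>In characteristic 2 the roots 1 and -1 of \<open>eps_square\<close>
    coincide.\<close>
  have "(\<epsilon> - 1) * (\<epsilon> - 1) = \<epsilon> * \<epsilon> + 1 - (\<epsilon> + \<epsilon>)" by (simp add: algebra_simps)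
  also have "\<dots> = 0" by (simp only: eps_square double diff_zero)
  finally have "(\<epsilon> - 1) * (\<epsilon> - 1) = 0" .
  then have eps: "\<epsilon> = 1" by simp
  have sign: "(- 1) ^ j = (1::'a)" for j by (simp only: minus power_one)
  have "k < m - 1"
  proof (rule ccontr)
    assume "\<not> k < m - 1"
    then have "k = m - 1 \<or> k \<ge> m" by linarith
    then show False using False alt[of u] N_pow_ge[of k u] unfolding top_form_def by auto
  qed
  \<comment> \<open>For odd \<open>k\<close>, the two terms of \<open>self_form_swap\<close> at the
    even index \<open>k - 1\<close> that agree by \<open>form_T_pow_double\<close> cancel; what is
    left says that the self-pairing at \<open>k\<close> is zero.\<close>
  have "even k"
  proof (rule ccontr)
    assume "odd k"
    then obtain s where s: "k = 2 * s + 1" by (auto elim: oddE)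
    have 1: "f u ((T ^^ (2 * s)) u) = f u ((N ^^ (2 * s)) u)"
      by (rule form_T_pow_double[OF two eps]) (use good s in auto)
    have "f u ((T ^^ (2 * s)) (N u)) = (- 1) ^ (2 * s) * f u ((N ^^ (2 * s)) (N u))"
    proof (rule form_T_pow)
      fix i assume "i > 2 * s"
      then show "f u ((N ^^ i) (N u)) = 0" using good[of "Suc i"] s by (simp add: funpow_swap1)
    qed
    then have "f u ((T ^^ (2 * s)) (N u)) = f u ((N ^^ k) u)" unfolding s by (simp add: funpow_swap1)
    then show False using self_form_swap[of u "2 * s"] 1 eps False by simp
  qed
  then obtain s where s: "k = 2 * s" by (auto elim: evenE)
  \<comment> \<open>One less than \<open>m - 1 - k\<close>, for which the linear coefficient would
    be twice the top pairing, hence zero. Here the two terms of order \<open>k + l\<close> agree and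
    cancel, and the one with \<open>N ^^ Suc l\<close> contributes a single top pairing.\<close>
  define l where "l = m - 2 - k"
  have kl: "k + l + 2 = m" using \<open>k < m - 1\<close> unfolding l_def by linarith
  define q where "q = f w ((T ^^ l) ((N ^^ (k + l)) w))"
  \<comment> \<open>The equation for \<open>a\<close> at index \<open>k\<close>, with quadratic
    coefficient \<open>q\<close>. For nonzero \<open>q\<close> the substitution
    \<open>a = t * h / q\<close> makes it an Artin--Schreier equation times
    \<open>h * h / q\<close>.\<close>
  obtain a where a: "f u ((N ^^ k) u) + a * top_form u w + a * a * q = 0"
  proof (cases "q = 0")
    case True
    then show ?thesis using that[of "- f u ((N ^^ k) u) / top_form u w"] top by simp
  next
    case False
    define h where "h = top_form u w"
    define d where "d = f u ((N ^^ k) u)"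
    obtain t where t: "t * t + t + d * q / (h * h) = 0" using quadratic by blast
    have h: "h \<noteq> 0" using top unfolding h_def .
    have "d + (t * h / q) * h + (t * h / q) * (t * h / q) * q
      = (h * h / q) * (t * t + t + d * q / (h * h))"
      using False h by (simp add: field_simps)
    then show ?thesis using that[of "t * h / q"] t unfolding h_def d_def by simp
  qed
  define u' where "u' = u + scale a ((N ^^ l) w)"
  have N0: "(N ^^ i) w = 0" if "i \<ge> k + l + 2" for i
    using that kl by (simp add: N_pow_ge)
  have N1: "(N ^^ (k + l + 1)) w = (N ^^ (m - 1)) w"
  proof -
    have "k + l + 1 = m - 1" using kl by linarith
    then show ?thesis by (simp only:)
  qed
  have "f u' ((N ^^ j) u') = 0" if "j \<ge> k" for j
  proof -
    \<comment> \<open>As \<open>l\<close> is one smaller, the shift also affects index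
      \<open>k + 1\<close>: there two equal top pairings cancel, and the quadratic term is
      \<open>top_form w w\<close> if \<open>l = 0\<close> and of order at least \<open>m\<close>
      otherwise. From \<open>k + 2\<close> on, all terms with \<open>w\<close> vanish.\<close>
    have "j = k \<or> j = k + 1 \<or> j \<ge> k + 2" using that by linarith
    then consider "j = k" | "j = k + 1" | "j \<ge> k + 2" by blast
    then show ?thesis
    proof cases
      case 1
      have T1: "f u ((T ^^ k) ((N ^^ Suc l) w)) = top_form u w"
      proof -
        have "f u ((T ^^ k) ((N ^^ Suc l) w)) = (- 1) ^ k * f u ((N ^^ k) ((N ^^ Suc l) w))"
          by (rule form_T_pow) (simp only: N_pow_N_pow, subst N0, auto)
        then show ?thesis unfolding sign N_pow_N_pow top_form_def N1[symmetric] by simp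
      qed
      have T0: "f u ((T ^^ k) ((N ^^ l) w)) = f u ((N ^^ (k + l)) w)"
      proof -
        have "f u ((T ^^ (2 * s)) ((N ^^ l) w)) = f u ((N ^^ (2 * s)) ((N ^^ l) w))"
          by (rule form_T_pow_double[OF two eps]) (use s in \<open>simp only: N_pow_N_pow, subst N0, auto\<close>)
        then show ?thesis by (simp add: s N_pow_N_pow)
      qed
      have "f u' ((N ^^ j) u') = f u ((N ^^ k) u) + a * (f u ((N ^^ (k + l)) w) + top_form u w + f u ((N ^^ (k + l)) w)) + a * a * q"
        unfolding u'_def self_form_shift 1 T0 T1 eps q_def by simp
      also have "\<dots> = f u ((N ^^ k) u) + a * (top_form u w + (f u ((N ^^ (k + l)) w) + f u ((N ^^ (k + l)) w))) + a * a * q"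
        by (simp only: ac_simps)
      also have "\<dots> = 0" unfolding double using a by simp
      finally show ?thesis .
    next
      case 2
      have T0: "f u ((T ^^ j) ((N ^^ l) w)) = f u ((N ^^ (j + l)) w)"
      proof -
        have "f u ((T ^^ j) ((N ^^ l) w)) = (- 1) ^ j * f u ((N ^^ j) ((N ^^ l) w))"
          by (rule form_T_pow) (simp only: N_pow_N_pow, subst N0, auto simp: 2)
        then show ?thesis unfolding sign N_pow_N_pow by simp
      qed
      have T1: "f u ((T ^^ j) ((N ^^ Suc l) w)) = 0"
        by (rule form_T_pow_eq_0) (simp only: N_pow_N_pow, subst N0, auto simp: 2)
      have T2: "f w ((T ^^ l) ((N ^^ (j + l)) w)) = 0"
      proof (cases "l = 0")
        case True
        then show ?thesis using alt[of w] N1 2 unfolding top_form_def by simp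
      next
        case False
        then show ?thesis
          by (intro form_T_pow_eq_0) (simp only: N_pow_N_pow, subst N0, auto simp: 2)
      qed
      show ?thesis unfolding u'_def self_form_shift T0 T1 T2 eps
        using good[of j] 2 double by simp
    next
      case 3
      have T0: "f u ((T ^^ j) ((N ^^ l) w)) = 0"
        by (rule form_T_pow_eq_0) (use 3 in \<open>simp only: N_pow_N_pow, subst N0, auto\<close>)
      have T1: "f u ((T ^^ j) ((N ^^ Suc l) w)) = 0"
        by (rule form_T_pow_eq_0) (use 3 in \<open>simp only: N_pow_N_pow, subst N0, auto\<close>)
      have "(N ^^ (j + l)) w = 0" using 3 by (intro N0) simp
      then show ?thesis unfolding u'_def self_form_shift T0 T1 using good[of j] 3 by simp
    qed
  qed
  moreover have "top_form u' w \<noteq> 0" using top_form_shift[OF alt] top unfolding u'_def by simp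
  ultimately show ?thesis by blast
qed

text \<open>Downward induction on the smallest index handled, starting at \<open>m\<close>, where
  nilpotency suffices. The hypothesis \<open>quadratic\<close> covers both characteristics.\<close>

lemma isotropic_exists:
  assumes quadratic: "(2::'a) \<noteq> 0 \<or> (\<forall>c::'a. \<exists>t. t * t + t + c = 0)"
    and alt: "\<And>v. top_form v v = 0" and top: "top_form u w \<noteq> 0"
  obtains u' where "top_form u' w \<noteq> 0" "\<And>i. f u' ((N ^^ i) u') = 0"
proof -
  have "\<exists>u'. top_form u' w \<noteq> 0 \<and> (\<forall>i. i + d \<ge> m \<longrightarrow> f u' ((N ^^ i) u') = 0)" for d
  proof (induction d)
    case 0
    then show ?case using top by (auto simp: N_pow_ge)
  next
    case (Suc d)
    then obtain v where v: "top_form v w \<noteq> 0" "\<And>i. i + d \<ge> m \<Longrightarrow> f v ((N ^^ i) v) = 0" by auto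
    define k where "k = m - Suc d"
    have "\<exists>u'. top_form u' w \<noteq> 0 \<and> (\<forall>i\<ge>k. f u' ((N ^^ i) u') = 0)"
    proof (cases "(2::'a) = 0")
      case True
      then show ?thesis
        using isotropic_step_2[OF True _ alt v(1), of k] v(2) quadratic unfolding k_def by auto
    next
      case False
      then show ?thesis
        using isotropic_step_not_2[OF False alt v(1), of k] v(2) unfolding k_def by auto
    qed
    then obtain u' where "top_form u' w \<noteq> 0" "\<And>i. i \<ge> k \<Longrightarrow> f u' ((N ^^ i) u') = 0" by blast
    then show ?case unfolding k_def by (intro exI[of _ u']) auto
  qed
  from this[of m] show ?thesis using that by auto
qed

section \<open>From two isotropic generators to the Gram matrix\<close>

lemma normal_form_gram_exists:
  assumes quadratic: "(2::'a) \<noteq> 0 \<or> (\<forall>c::'a. \<exists>t. t * t + t + c = 0)"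
    and alt: "\<And>v. top_form v v = 0" and top: "top_form u w \<noteq> 0"
  obtains vs where "length vs = 2 * m" "gram_matrix f vs = normal_form_matrix m \<epsilon>"
proof -
  obtain e' where e': "top_form e' w \<noteq> 0" "\<And>i. f e' ((N ^^ i) e') = 0"
    using isotropic_exists[OF assms] by blast
  \<comment> \<open>Symmetry up to sign of \<open>top_form\<close> allows the roles to be exchanged:
    now \<open>w\<close> is corrected, with \<open>e'\<close> as the fixed partner.\<close>
  have "\<epsilon> \<noteq> 0" using eps_square by auto
  then have "top_form w e' \<noteq> 0" using e'(1) top_form_swap[of w e'] by simp
  then obtain g where g: "top_form g e' \<noteq> 0" "\<And>i. f g ((N ^^ i) g) = 0"
    using isotropic_exists[OF quadratic alt] by blast
  \<comment> \<open>A dual normalisation inside the cyclic submodule of \<open>e'\<close>: the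
    powers of \<open>N\<close> on \<open>e\<close> and, in reverse order, the powers of
    \<open>T\<close> on \<open>g\<close> become dual to each other.\<close>
  obtain e where e: "e \<in> orbit_span 0 e'" "\<And>i. i < m \<Longrightarrow> f g ((N ^^ i) e) = (if i = m - 1 then 1 else 0)"
    using orbit_span_solve[of g e' "\<lambda>i. if i = m - 1 then 1 else 0"] g(1) unfolding top_form_def by blast
  define E where "E i = (N ^^ i) e" for i
  define G where "G j = (T ^^ (m - 1 - j)) g" for j
  have E: "E i \<in> orbit_span 0 e'" for i
    unfolding E_def using N_pow_orbit_span[OF e(1), of i] orbit_span_antimono[of 0 "i + 0"] by blast
  have G: "G j \<in> orbit_span 0 g" for j
    unfolding G_def using T_pow_orbit_span[OF self_in_orbit_span, of "m - 1 - j" g]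
      orbit_span_antimono[of 0 "m - 1 - j + 0"] by blast
  have EE: "f (E i) (E j) = 0" for i j by (rule orbit_span_isotropic[OF e'(2) E E])
  have GG: "f (G i) (G j) = 0" for i j by (rule orbit_span_isotropic[OF g(2) G G])
  have GE: "f (G j) (E i) = (if i = j then 1 else 0)" if "j < m" for i j
  proof -
    have "f (G j) (E i) = f g ((N ^^ (m - 1 - j + i)) e)"
      unfolding G_def E_def by (simp add: adjoint_T_pow N_pow_N_pow)
    also have "\<dots> = (if i = j then 1 else 0)"
    proof (cases "m - 1 - j + i < m")
      case True
      then show ?thesis using e(2)[OF True] that by auto
    next
      case False
      then show ?thesis using that by (auto simp: N_pow_ge)
    qed
    finally show ?thesis .
  qed
  have EG: "f (E i) (G j) = (if i = j then \<epsilon> else if Suc i = j then 1 else 0)" if "j < m" for i j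
  proof -
    \<comment> \<open>The \<open>N\<close> in \<open>swap\<close> shifts \<open>i\<close> by one,
      which produces the off-diagonal ones of the Jordan block; the other term produces its
      diagonal.\<close>
    have "f (E i) (G j) = f (G j) (E (Suc i)) + \<epsilon> * f (G j) (E i)"
      using swap[of "E i" "G j"] unfolding E_def by simp
    then show ?thesis using GE[OF that] by simp
  qed
  define vs where "vs = map E [0..<m] @ map G [0..<m]"
  have len: "length vs = m + m" unfolding vs_def by simp
  have nth: "vs ! i = (if i < m then E i else G (i - m))" if "i < m + m" for i
    using that unfolding vs_def by (auto simp: nth_append)
  have "gram_matrix f vs = normal_form_matrix m \<epsilon>"
    unfolding gram_matrix_def normal_form_matrix_def lower_jordan_block_def
    by (rule eq_matI) (auto simp: len nth EE GG EG GE)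
  then show ?thesis by (intro that[of vs]) (simp_all add: len)
qed

end

subsection \<open>The asymmetry of a non-degenerate form\<close>

lemma bilinear_form_simps:
  assumes "bilinear_form scale f"
  shows "f u (v + w) = f u v + f u w" "f (v + w) u = f v u + f w u"
    "f u (scale a v) = a * f u v" "f (scale a v) u = a * f v u"
  using assms unfolding bilinear_form_def Vector_Spaces.linear_iff by auto

lemma bilinear_form_zero:
  assumes "bilinear_form scale f"
  shows "f u 0 = 0" "f 0 u = 0"
  using bilinear_form_simps(1)[OF assms, of u 0 0] bilinear_form_simps(2)[OF assms, of 0 0 u]
  by (simp_all only: add_0 add_cancel_right_right)

lemma bilinear_form_sum:
  assumes "bilinear_form scale f"
  shows "f u (\<Sum>i\<in>I. scale (c i) (x i)) = (\<Sum>i\<in>I. c i * f u (x i))"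
    and "f (\<Sum>i\<in>I. scale (c i) (x i)) u = (\<Sum>i\<in>I. c i * f (x i) u)"
proof -
  note [simp] = bilinear_form_simps[OF assms]
  note z = bilinear_form_zero[OF assms]
  show "f u (\<Sum>i\<in>I. scale (c i) (x i)) = (\<Sum>i\<in>I. c i * f u (x i))"
    by (induction I rule: infinite_finite_induct) (auto simp: z)
  show "f (\<Sum>i\<in>I. scale (c i) (x i)) u = (\<Sum>i\<in>I. c i * f (x i) u)"
    by (induction I rule: infinite_finite_induct) (auto simp: z)
qed

lemma (in finite_dimensional_vector_space) basis_list_exists:
  obtains vs where "is_basis scale vs"
proof -
  obtain vs where "set vs = Basis" "distinct vs"
    using finite_distinct_list[OF finite_Basis] by auto
  then show ?thesis using that independent_Basis span_Basis unfolding is_basis_def by auto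
qed

lemma (in vector_space) span_UNIV_induct:
  assumes "span S = UNIV"
    and "\<And>x y. P x \<Longrightarrow> P y \<Longrightarrow> P (x + y)" "\<And>a x. P x \<Longrightarrow> P (scale a x)" "P 0"
    and "\<And>x. x \<in> S \<Longrightarrow> P x"
  shows "P x"
proof -
  have "subspace {x. P x}" using assms(2-4) by (intro subspaceI) auto
  then show ?thesis using span_minimal[of S "{x. P x}"] assms(1,5) by auto
qed

text \<open>Each functional vanishes on the span of the other vectors but not on its own, so no
  vector lies in the span of the rest.\<close>

lemma (in vector_space) independent_if_dual_functionals:
  fixes \<phi> :: "nat \<Rightarrow> 'b \<Rightarrow> 'a"
  assumes linear: "\<And>i u v. i < length vs \<Longrightarrow> \<phi> i (u + v) = \<phi> i u + \<phi> i v"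
      "\<And>i a v. i < length vs \<Longrightarrow> \<phi> i (scale a v) = a * \<phi> i v"
    and dual: "\<And>i j. i < length vs \<Longrightarrow> j < length vs \<Longrightarrow> \<phi> i (vs ! j) = (if i = j then 1 else 0)"
  shows "distinct vs \<and> independent (set vs)"
proof
  show "distinct vs"
    unfolding distinct_conv_nth using dual by (metis one_neq_zero)
  show "independent (set vs)"
  proof
    assume "dependent (set vs)"
    then obtain v where v: "v \<in> set vs" "v \<in> span (set vs - {v})" unfolding dependent_def by auto
    then obtain i where i: "i < length vs" "v = vs ! i" by (auto simp: in_set_conv_nth)
    have "subspace {x. \<phi> i x = 0}"
      using linear[OF i(1)] linear(2)[OF i(1), of 0 0] by (intro subspaceI) auto
    moreover have "set vs - {v} \<subseteq> {x. \<phi> i x = 0}"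
      using dual i by (auto simp: in_set_conv_nth)
    ultimately have "\<phi> i v = 0" using span_minimal v(2) by blast
    then show False using dual[OF i(1) i(1)] i(2) by simp
  qed
qed

section \<open>Dual bases, and the existence and properties of the asymmetry\<close>

locale nondegenerate_form = finite_dimensional_vector_space scale Basis
  for scale :: "'a::field \<Rightarrow> 'v::ab_group_add \<Rightarrow> 'v" and Basis +
  fixes f :: "'v \<Rightarrow> 'v \<Rightarrow> 'a"
  assumes bilinear: "bilinear_form scale f" and nondegenerate: "nondegenerate scale f"
begin

lemmas form_simps [simp] = bilinear_form_simps[OF bilinear]
lemmas form_sum = bilinear_form_sum[OF bilinear]

lemma form_zero [simp]: "f u 0 = 0" "f 0 u = 0"
  by (rule bilinear_form_zero[OF bilinear])+

lemma form_minus [simp]: "f u (- v) = - f u v" "f (- v) u = - f v u"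
  using form_simps(1)[of u v "- v"] form_simps(2)[of v "- v" u]
  by (auto simp: eq_neg_iff_add_eq_0 add.commute)

lemma form_diff [simp]: "f u (v - w) = f u v - f u w" "f (v - w) u = f v u - f w u"
  using form_simps(1)[of u v "- w"] form_simps(2)[of v "- w" u] by auto

text \<open>The columns of the inverse Gram matrix are the coordinates of a right dual basis, its
  rows those of a left dual basis.\<close>

lemma dual_bases_exist:
  obtains vs d d' where "is_basis scale vs"
    "\<And>i k. i < length vs \<Longrightarrow> k < length vs \<Longrightarrow> f (vs ! i) (d k) = (if i = k then 1 else 0)"
    "\<And>i k. i < length vs \<Longrightarrow> k < length vs \<Longrightarrow> f (d' k) (vs ! i) = (if i = k then 1 else 0)"
proof -
  obtain vs where vs: "is_basis scale vs" by (rule basis_list_exists)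
  define n where "n = length vs"
  define G where "G = gram_matrix f vs"
  have "invertible_mat G" using nondegenerate vs unfolding nondegenerate_def G_def by auto
  then obtain B where GB: "G * B = 1\<^sub>m (dim_row G)" and BG: "B * G = 1\<^sub>m (dim_row B)"
    unfolding invertible_mat_def inverts_mat_def by auto
  have G: "G \<in> carrier_mat n n" unfolding G_def gram_matrix_def n_def by auto
  have B: "B \<in> carrier_mat n n"
    using GB BG G by (metis carrier_matD carrier_matI index_mult_mat(3) index_one_mat(3))
  have Gij: "G $$ (i, j) = f (vs ! i) (vs ! j)" if "i < n" "j < n" for i j
    using that unfolding G_def gram_matrix_def n_def by auto
  define d where "d k = (\<Sum>j<n. scale (B $$ (j, k)) (vs ! j))" for k
  define d' where "d' k = (\<Sum>j<n. scale (B $$ (k, j)) (vs ! j))" for k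
  have "f (vs ! i) (d k) = (if i = k then 1 else 0)" if "i < n" "k < n" for i k
  proof -
    have "f (vs ! i) (d k) = (\<Sum>j<n. G $$ (i, j) * B $$ (j, k))"
      unfolding d_def form_sum using that by (intro sum.cong) (auto simp: Gij)
    also have "\<dots> = (G * B) $$ (i, k)"
      using G B that by (simp add: scalar_prod_def atLeast0LessThan)
    also have "\<dots> = (if i = k then 1 else 0)" using G that unfolding GB by simp
    finally show ?thesis .
  qed
  moreover have "f (d' k) (vs ! i) = (if i = k then 1 else 0)" if "i < n" "k < n" for i k
  proof -
    have "f (d' k) (vs ! i) = (\<Sum>j<n. B $$ (k, j) * G $$ (j, i))"
      unfolding d'_def form_sum using that by (intro sum.cong) (auto simp: Gij)
    also have "\<dots> = (B * G) $$ (k, i)"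
      using G B that by (simp add: scalar_prod_def atLeast0LessThan)
    also have "\<dots> = (if i = k then 1 else 0)" using B that unfolding BG by simp
    finally show ?thesis .
  qed
  ultimately show ?thesis using vs that unfolding n_def by blast
qed

text \<open>The left dual basis reads off the coordinates of \<open>y\<close> in \<open>vs\<close>,
  and all of them vanish.\<close>

lemma form_right_eq_0:
  assumes "\<And>x. f x y = 0"
  shows "y = 0"
proof -
  obtain vs d d' where vs: "is_basis scale vs"
    "\<And>i k. i < length vs \<Longrightarrow> k < length vs \<Longrightarrow> f (d' k) (vs ! i) = (if i = k then 1 else 0)"
    by (rule dual_bases_exist) blast
  have "y = (\<Sum>k<length vs. scale (f (d' k) y) (vs ! k))" for y
  proof (rule span_UNIV_induct[of "set vs" "\<lambda>y. y = (\<Sum>k<length vs. scale (f (d' k) y) (vs ! k))"])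
    fix x assume "x \<in> set vs"
    then obtain i where i: "i < length vs" "x = vs ! i" by (auto simp: in_set_conv_nth)
    have "(\<Sum>k<length vs. scale (f (d' k) x) (vs ! k)) = (\<Sum>k<length vs. if i = k then vs ! k else 0)"
      using vs(2) i by (intro sum.cong) auto
    then show "x = (\<Sum>k<length vs. scale (f (d' k) x) (vs ! k))" using i by simp
  next
    fix x y assume xy: "x = (\<Sum>k<length vs. scale (f (d' k) x) (vs ! k))"
      "y = (\<Sum>k<length vs. scale (f (d' k) y) (vs ! k))"
    have "(\<Sum>k<length vs. scale (f (d' k) (x + y)) (vs ! k))
        = (\<Sum>k<length vs. scale (f (d' k) x) (vs ! k)) + (\<Sum>k<length vs. scale (f (d' k) y) (vs ! k))"
      by (simp add: scale_left_distrib sum.distrib)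
    then show "x + y = (\<Sum>k<length vs. scale (f (d' k) (x + y)) (vs ! k))" using xy by metis
  next
    fix a x assume x: "x = (\<Sum>k<length vs. scale (f (d' k) x) (vs ! k))"
    have "(\<Sum>k<length vs. scale (f (d' k) (scale a x)) (vs ! k))
        = scale a (\<Sum>k<length vs. scale (f (d' k) x) (vs ! k))"
      by (simp add: scale_sum_right)
    then show "scale a x = (\<Sum>k<length vs. scale (f (d' k) (scale a x)) (vs ! k))" using x by metis
  qed (use vs(1) in \<open>auto simp: is_basis_def\<close>)
  from this[of y] show ?thesis using assms by simp
qed

lemma form_left_eqI:
  assumes "\<And>x. f x y = f x z"
  shows "y = z"
  using form_right_eq_0[of "y - z"] assms by simp

text \<open>The required values \<open>f v (vs ! k)\<close> serve as coefficients of
  \<open>\<tau> v\<close> in the right dual basis. Non-degeneracy gives linearity and injectivity,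
  and finite dimension then surjectivity.\<close>

lemma asymmetry_exists: "\<exists>\<tau>. \<tau> \<in> GL scale \<and> (\<forall>u v. f v u = f u (\<tau> v))"
proof -
  obtain vs d d' where vs: "is_basis scale vs"
    "\<And>i k. i < length vs \<Longrightarrow> k < length vs \<Longrightarrow> f (vs ! i) (d k) = (if i = k then 1 else 0)"
    by (rule dual_bases_exist) blast
  define \<tau> where "\<tau> v = (\<Sum>k<length vs. scale (f v (vs ! k)) (d k))" for v
  have eq: "f v u = f u (\<tau> v)" for u v
  proof (rule span_UNIV_induct[of "set vs" "\<lambda>u. f v u = f u (\<tau> v)"])
    fix x assume "x \<in> set vs"
    then obtain i where i: "i < length vs" "x = vs ! i" by (auto simp: in_set_conv_nth)
    have "f x (\<tau> v) = (\<Sum>k<length vs. f v (vs ! k) * f x (d k))"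
      unfolding \<tau>_def by (rule form_sum)
    also have "\<dots> = (\<Sum>k<length vs. if i = k then f v (vs ! k) else 0)"
      using vs(2) i by (intro sum.cong) auto
    finally show "f v x = f x (\<tau> v)" using i by simp
  qed (use vs(1) in \<open>auto simp: is_basis_def\<close>)
  have linear: "Vector_Spaces.linear scale scale \<tau>"
    unfolding Vector_Spaces.linear_iff
    using vector_space_axioms form_left_eqI by (auto intro!: form_left_eqI simp flip: eq)
  have "inj \<tau>"
  proof (rule injI)
    fix x y assume "\<tau> x = \<tau> y"
    \<comment> \<open>By \<open>eq\<close>, a vector in the left radical also lies in the right
      radical.\<close>
    then have "f (x - y) u = 0" for u using eq[of x u] eq[of y u] by simp
    then have "f u (x - y) = 0" for u using eq[of u "x - y"] by simp
    then show "x = y" using form_right_eq_0[of "x - y"] by simp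
  qed
  then have "bij \<tau>" using linear_inj_imp_surj[OF linear] by (simp add: bij_def)
  then show ?thesis using eq linear unfolding GL_def by blast
qed

abbreviation \<sigma> :: "'v \<Rightarrow> 'v" where "\<sigma> \<equiv> asymmetry scale f"

lemma asymmetry_GL: "\<sigma> \<in> GL scale" and asymmetry_swap: "f v u = f u (\<sigma> v)"
proof -
  have "\<exists>!\<sigma>. \<sigma> \<in> GL scale \<and> (\<forall>u v. f v u = f u (\<sigma> v))"
    using asymmetry_exists
  proof (rule ex_ex1I)
    fix \<sigma> \<tau> assume "\<sigma> \<in> GL scale \<and> (\<forall>u v. f v u = f u (\<sigma> v))" "\<tau> \<in> GL scale \<and> (\<forall>u v. f v u = f u (\<tau> v))"
    then show "\<sigma> = \<tau>" by (intro ext form_left_eqI) metis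
  qed
  from theI'[OF this] show "\<sigma> \<in> GL scale" "f v u = f u (\<sigma> v)"
    unfolding asymmetry_def by auto
qed

lemma asymmetry_linear: "Vector_Spaces.linear scale scale \<sigma>" and asymmetry_bij: "bij \<sigma>"
  using asymmetry_GL unfolding GL_def by auto

lemma asymmetry_add [simp]: "\<sigma> (u + v) = \<sigma> u + \<sigma> v"
  and asymmetry_scale [simp]: "\<sigma> (scale a v) = scale a (\<sigma> v)"
  using asymmetry_linear unfolding Vector_Spaces.linear_iff by auto

lemma asymmetry_isometry: "f (\<sigma> u) (\<sigma> v) = f u v"
  using asymmetry_swap[of v "\<sigma> u"] asymmetry_swap[of u v] by simp

lemma inv_asymmetry [simp]: "\<sigma> (inv_into UNIV \<sigma> v) = v" "inv_into UNIV \<sigma> (\<sigma> v) = v"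
  using asymmetry_bij by (auto simp: bij_is_surj surj_f_inv_f bij_is_inj)

lemma inv_asymmetry_add [simp]: "inv_into UNIV \<sigma> (u + v) = inv_into UNIV \<sigma> u + inv_into UNIV \<sigma> v"
  by (metis inv_asymmetry asymmetry_add)

lemma inv_asymmetry_scale [simp]: "inv_into UNIV \<sigma> (scale a v) = scale a (inv_into UNIV \<sigma> v)"
  by (metis inv_asymmetry asymmetry_scale)

lemma asymmetry_diff [simp]: "\<sigma> (u - v) = \<sigma> u - \<sigma> v"
  by (metis asymmetry_add diff_add_cancel eq_diff_eq)

lemma inv_asymmetry_diff [simp]: "inv_into UNIV \<sigma> (u - v) = inv_into UNIV \<sigma> u - inv_into UNIV \<sigma> v"
  by (metis inv_asymmetry_add diff_add_cancel eq_diff_eq)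

text \<open>Adjointness is the isometry property applied to a preimage of \<open>v\<close>;
  \<open>T_eq\<close> comes from cancelling \<open>\<sigma>\<close> against its inverse and from
  \<open>\<epsilon> * \<epsilon> = 1\<close>.\<close>

lemma unipotent_isometry_asymmetry:
  assumes "\<epsilon> \<in> {1, -1}" "m \<ge> 1" "\<And>v. ((\<lambda>v. \<sigma> v - scale \<epsilon> v) ^^ m) v = 0"
  shows "unipotent_isometry scale f (\<lambda>v. \<sigma> v - scale \<epsilon> v) (\<lambda>v. inv_into UNIV \<sigma> v - scale \<epsilon> v) \<epsilon> m"
proof (intro unipotent_isometry.intro unipotent_isometry_axioms.intro)
  have sq: "\<epsilon> * \<epsilon> = 1" using assms(1) by auto
  then show "\<epsilon> * \<epsilon> = 1" .
  have sq': "\<epsilon> * (\<epsilon> * a) = a" for a using sq by (simp flip: mult.assoc)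
  show "Vector_Spaces.linear scale scale (\<lambda>v. \<sigma> v - scale \<epsilon> v)"
    "Vector_Spaces.linear scale scale (\<lambda>v. inv_into UNIV \<sigma> v - scale \<epsilon> v)"
    unfolding Vector_Spaces.linear_iff using vector_space_axioms by (auto simp: algebra_simps)
  show "f v u = f u (\<sigma> v - scale \<epsilon> v) + \<epsilon> * f u v" for u v
    using asymmetry_swap[of v u] by simp
  show "f (\<sigma> u - scale \<epsilon> u) v = f u (inv_into UNIV \<sigma> v - scale \<epsilon> v)" for u v
    using asymmetry_isometry[of u "inv_into UNIV \<sigma> v"] by simp
  show "inv_into UNIV \<sigma> v - scale \<epsilon> v = - (\<sigma> v - scale \<epsilon> v)
      - scale \<epsilon> (inv_into UNIV \<sigma> (\<sigma> v - scale \<epsilon> v) - scale \<epsilon> (\<sigma> v - scale \<epsilon> v))" for v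
    by (simp add: algebra_simps sq sq')
  show "\<sigma> (inv_into UNIV \<sigma> v - scale \<epsilon> v) - scale \<epsilon> (inv_into UNIV \<sigma> v - scale \<epsilon> v)
      = inv_into UNIV \<sigma> (\<sigma> v - scale \<epsilon> v) - scale \<epsilon> (\<sigma> v - scale \<epsilon> v)" for v
    by (simp add: algebra_simps)
qed (use assms bilinear vector_space_axioms in auto)

end

subsection \<open>The action of polynomials\<close>

context vector_space begin

lemma poly_action_eq_sum:
  assumes "n \<ge> Polynomial.degree q"
  shows "poly_action scale \<sigma> q v = (\<Sum>i\<le>n. scale (Polynomial.coeff q i) ((\<sigma> ^^ i) v))"
  unfolding poly_action_def
  by (rule sum.mono_neutral_left) (use assms in \<open>auto simp: Polynomial.coeff_eq_0\<close>)

lemma poly_action_add: "poly_action scale \<sigma> (p + q) v = poly_action scale \<sigma> p v + poly_action scale \<sigma> q v"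
proof -
  define n where "n = max (Polynomial.degree p) (Polynomial.degree q)"
  have "Polynomial.degree (p + q) \<le> n" unfolding n_def by (rule Polynomial.degree_add_le) auto
  then show ?thesis
    by (simp add: poly_action_eq_sum[of _ n] n_def scale_left_distrib sum.distrib)
qed

lemma poly_action_smult: "poly_action scale \<sigma> (Polynomial.smult a p) v = scale a (poly_action scale \<sigma> p v)"
  using poly_action_eq_sum[of "Polynomial.smult a p" "Polynomial.degree p" \<sigma> v]
  by (simp add: Polynomial.degree_smult_le poly_action_def scale_sum_right)

lemma poly_action_0: "poly_action scale \<sigma> 0 v = 0"
  by (simp add: poly_action_def)

lemma poly_action_1: "poly_action scale \<sigma> 1 v = v"
  by (simp add: poly_action_def)

lemma poly_action_pCons:
  assumes "Vector_Spaces.linear scale scale \<sigma>"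
  shows "poly_action scale \<sigma> (pCons a p) v = scale a v + \<sigma> (poly_action scale \<sigma> p v)"
proof -
  interpret \<sigma>: Vector_Spaces.linear scale scale \<sigma> by (rule assms)
  have "poly_action scale \<sigma> (pCons a p) v
      = (\<Sum>i\<le>Suc (Polynomial.degree p). scale (Polynomial.coeff (pCons a p) i) ((\<sigma> ^^ i) v))"
    by (rule poly_action_eq_sum) (rule Polynomial.degree_pCons_le)
  also have "\<dots> = scale a v + (\<Sum>i\<le>Polynomial.degree p. scale (Polynomial.coeff p i) (\<sigma> ((\<sigma> ^^ i) v)))"
    by (subst sum.atMost_Suc_shift) simp
  also have "\<dots> = scale a v + \<sigma> (poly_action scale \<sigma> p v)"
    by (simp add: poly_action_def \<sigma>.sum \<sigma>.scale)
  finally show ?thesis .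
qed

lemma poly_action_linear_power_mult:
  assumes "Vector_Spaces.linear scale scale \<sigma>"
  shows "poly_action scale \<sigma> ([:-\<epsilon>, 1:] ^ i * p) v = ((\<lambda>v. \<sigma> v - scale \<epsilon> v) ^^ i) (poly_action scale \<sigma> p v)"
proof (induction i)
  case (Suc i)
  have *: "[:-\<epsilon>, 1:] * r = Polynomial.smult (- \<epsilon>) r + pCons 0 r" for r by simp
  have "poly_action scale \<sigma> ([:-\<epsilon>, 1:] ^ Suc i * p) v = poly_action scale \<sigma> ([:-\<epsilon>, 1:] * ([:-\<epsilon>, 1:] ^ i * p)) v"
    by (simp only: power_Suc mult.assoc)
  also have "\<dots> = \<sigma> (poly_action scale \<sigma> ([:-\<epsilon>, 1:] ^ i * p) v) - scale \<epsilon> (poly_action scale \<sigma> ([:-\<epsilon>, 1:] ^ i * p) v)"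
    unfolding * poly_action_add poly_action_smult poly_action_pCons[OF assms] by simp
  finally show ?case unfolding Suc.IH by simp
qed simp

lemma poly_action_linear_power:
  assumes "Vector_Spaces.linear scale scale \<sigma>"
  shows "poly_action scale \<sigma> ([:-\<epsilon>, 1:] ^ i) v = ((\<lambda>v. \<sigma> v - scale \<epsilon> v) ^^ i) v"
  using poly_action_linear_power_mult[OF assms, of \<epsilon> i 1 v] by (simp add: poly_action_1)

text \<open>Condenses the elementary divisors into facts about \<open>N\<close> alone: nilpotency, a
  bound of \<open>2 * m\<close> on the dimension through the spanning set, and two independent
  vectors in the image of \<open>N ^^ (m - 1)\<close>.\<close>

lemma equal_pair_generators:
  assumes linear: "Vector_Spaces.linear scale scale \<sigma>" and "m \<ge> 1"
    and "has_elementary_divisors scale \<sigma> {#[:-\<epsilon>, 1:] ^ m, [:-\<epsilon>, 1:] ^ m#}"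
  defines "N \<equiv> \<lambda>v. \<sigma> v - scale \<epsilon> v"
  obtains w0 w1 where "\<And>v. (N ^^ m) v = 0" "span ((\<lambda>i. (N ^^ i) w0) ` {..<m} \<union> (\<lambda>i. (N ^^ i) w1) ` {..<m}) = UNIV"
    "\<And>a b. scale a ((N ^^ (m - 1)) w0) = scale b ((N ^^ (m - 1)) w1) \<Longrightarrow> a = 0 \<and> b = 0"
proof -
  interpret \<sigma>: Vector_Spaces.linear scale scale \<sigma> by (rule linear)
  define q where "q = [:-\<epsilon>, 1:] ^ m"
  obtain qs ws where qs: "mset qs = {#q, q#}" "length ws = length qs"
    "\<And>i. i < length qs \<Longrightarrow> annihilator scale \<sigma> (ws ! i) = {r. qs ! i dvd r}"
    "\<And>v. \<exists>!us. length us = length qs \<and>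
       (\<forall>i<length qs. us ! i \<in> cyclic_submodule scale \<sigma> (ws ! i)) \<and> v = sum_list us"
    using assms(3) unfolding has_elementary_divisors_def q_def by blast
  have len: "length qs = 2" using qs(1) by (metis size_mset size_add_mset size_empty numeral_2_eq_2)
  have "set qs = {q}" using qs(1) by (metis set_mset_mset set_mset_add_mset_insert set_mset_empty insert_absorb2)
  then have nth: "qs ! i = q" if "i < 2" for i using that len nth_mem[of i qs] by simp
  define w0 where "w0 = ws ! 0"
  define w1 where "w1 = ws ! 1"
  have ann: "poly_action scale \<sigma> r w = 0 \<longleftrightarrow> q dvd r" if "w \<in> {w0, w1}" for r w
    using qs(3)[of 0] qs(3)[of 1] nth len that unfolding annihilator_def w0_def w1_def by auto
  have all_less_2: "(\<forall>i<2. P i) \<longleftrightarrow> P 0 \<and> P 1" for P :: "nat \<Rightarrow> bool"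
    by (auto simp: less_2_cases_iff)
  have decomp: "\<exists>!us. length us = 2 \<and> us ! 0 \<in> cyclic_submodule scale \<sigma> w0 \<and>
       us ! 1 \<in> cyclic_submodule scale \<sigma> w1 \<and> v = sum_list us" for v
    using qs(4)[of v] unfolding len all_less_2 w0_def w1_def by (simp add: conj_assoc)
  have decompE: "\<exists>r s. v = poly_action scale \<sigma> r w0 + poly_action scale \<sigma> s w1" for v
  proof -
    obtain us where us: "length us = 2" "us ! 0 \<in> cyclic_submodule scale \<sigma> w0"
      "us ! 1 \<in> cyclic_submodule scale \<sigma> w1" "v = sum_list us" using decomp[of v] by blast
    have "us = [us ! 0, us ! 1]" using us(1) by (intro nth_equalityI) (auto simp: less_Suc_eq numeral_2_eq_2)
    then have "sum_list us = sum_list [us ! 0, us ! 1]" by (rule arg_cong)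
    then have "v = us ! 0 + us ! 1" using us(4) by simp
    moreover obtain r s where "us ! 0 = poly_action scale \<sigma> r w0" "us ! 1 = poly_action scale \<sigma> s w1"
      using us(2,3) unfolding cyclic_submodule_def by blast
    ultimately show ?thesis by metis
  qed
  have N_linear: "Vector_Spaces.linear scale scale N"
    unfolding Vector_Spaces.linear_iff N_def using vector_space_axioms
    by (auto simp: \<sigma>.add \<sigma>.scale algebra_simps)
  then have N: "N (u + v) = N u + N v" "N (scale a v) = scale a (N v)" for u v a
    unfolding Vector_Spaces.linear_iff by auto
  have N_pow_add: "(N ^^ i) (u + v) = (N ^^ i) u + (N ^^ i) v" for i u v
    by (induction i) (auto simp: N)
  have nil_w: "(N ^^ m) (poly_action scale \<sigma> r w) = 0" if "w \<in> {w0, w1}" for r w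
    using ann[OF that, of "q * r"] poly_action_linear_power_mult[OF linear, of \<epsilon> m r w]
    unfolding q_def N_def by simp
  have nil: "(N ^^ m) v = 0" for v
    using decompE[of v] nil_w by (auto simp: N_pow_add)
  define S where "S = (\<lambda>i. (N ^^ i) w0) ` {..<m} \<union> (\<lambda>i. (N ^^ i) w1) ` {..<m}"
  have S_pow: "(N ^^ i) w \<in> span S" if "w \<in> {w0, w1}" for i w
  proof (cases "i < m")
    case True
    then show ?thesis using that unfolding S_def by (auto intro!: span_base)
  next
    case False
    then have "(N ^^ i) w = (N ^^ (i - m)) ((N ^^ m) w)" using funpow_add[of "i - m" m N] by simp
    moreover have "(N ^^ j) 0 = 0" for j using N_pow_add[of j 0 0] by (simp only: add_0 add_cancel_right_right)
    ultimately show ?thesis using nil span_zero by simp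
  qed
  have S_N: "N x \<in> span S" if "x \<in> span S" for x
    using that
  proof (induction rule: span_induct_alt)
    case base
    have "N 0 = 0" using N(2)[of 0 0] by simp
    then show ?case by (simp add: span_zero)
  next
    case (step c x y)
    obtain i w where "w \<in> {w0, w1}" "x = (N ^^ i) w" using step(1) unfolding S_def by blast
    then have "N x \<in> span S" using S_pow[of w "Suc i"] by simp
    then show ?case using step(2) by (simp add: N span_add span_scale)
  qed
  have S_poly: "poly_action scale \<sigma> r w \<in> span S" if "w \<in> {w0, w1}" for r w
  proof (induction r)
    case 0
    then show ?case by (simp add: poly_action_0 span_zero)
  next
    case (pCons a r)
    define y where "y = poly_action scale \<sigma> r w"
    have "w \<in> span S" using S_pow[OF that, of 0] by simp
    \<comment> \<open>Since \<open>\<sigma>\<close> is \<open>N\<close> plus a scalar, stability of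
      the span under \<open>N\<close> gives stability under \<open>\<sigma>\<close>.\<close>
    moreover have "N y + scale \<epsilon> y \<in> span S"
      unfolding y_def by (intro span_add span_scale S_N pCons(2))
    then have "\<sigma> y \<in> span S" unfolding N_def by simp
    ultimately show ?case
      unfolding poly_action_pCons[OF linear] y_def by (intro span_add span_scale)
  qed
  have "v \<in> span S" for v using decompE[of v] S_poly span_add by fastforce
  then have span: "span S = UNIV" by auto
  \<comment> \<open>Otherwise the annihilator would contain a polynomial of degree
    \<open>m - 1\<close>, too small to be a multiple of \<open>q\<close>.\<close>
  have top: "(N ^^ (m - 1)) w \<noteq> 0" if "w \<in> {w0, w1}" for w
  proof
    assume "(N ^^ (m - 1)) w = 0"
    then have "q dvd [:-\<epsilon>, 1:] ^ (m - 1)"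
      using ann[OF that, of "[:-\<epsilon>, 1:] ^ (m - 1)"] poly_action_linear_power[OF linear, of \<epsilon> "m - 1" w]
      unfolding N_def by simp
    then have "Polynomial.degree q \<le> Polynomial.degree ([:-\<epsilon>, 1:] ^ (m - 1))"
      by (rule Polynomial.dvd_imp_degree_le) simp
    then show False using \<open>m \<ge> 1\<close> unfolding q_def degree_linear_power by simp
  qed
  have cyc: "scale a ((N ^^ i) w) \<in> cyclic_submodule scale \<sigma> w" for a i w
  proof -
    have "scale a ((N ^^ i) w) = poly_action scale \<sigma> (Polynomial.smult a ([:-\<epsilon>, 1:] ^ i)) w"
      unfolding N_def poly_action_smult poly_action_linear_power[OF linear] ..
    then show ?thesis unfolding cyclic_submodule_def by blast
  qed
  have "a = 0 \<and> b = 0" if "scale a ((N ^^ (m - 1)) w0) = scale b ((N ^^ (m - 1)) w1)" for a b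
  proof -
    \<comment> \<open>Two decompositions of 0 along the cyclic submodules satisfy this predicate;
      their uniqueness makes both components zero.\<close>
    let ?P = "\<lambda>us. length us = 2 \<and> us ! 0 \<in> cyclic_submodule scale \<sigma> w0 \<and>
       us ! 1 \<in> cyclic_submodule scale \<sigma> w1 \<and> 0 = sum_list us"
    have "?P [scale a ((N ^^ (m - 1)) w0), scale (- b) ((N ^^ (m - 1)) w1)]"
    proof (intro conjI)
      show "[scale a ((N ^^ (m - 1)) w0), scale (- b) ((N ^^ (m - 1)) w1)] ! 0 \<in> cyclic_submodule scale \<sigma> w0"
        unfolding nth_Cons_0 by (rule cyc)
      show "[scale a ((N ^^ (m - 1)) w0), scale (- b) ((N ^^ (m - 1)) w1)] ! 1 \<in> cyclic_submodule scale \<sigma> w1"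
        unfolding One_nat_def nth_Cons_Suc nth_Cons_0 by (rule cyc)
    qed (use that in simp_all)
    moreover have "?P [0, 0]" using cyc[of 0 0] by simp
    ultimately have "[scale a ((N ^^ (m - 1)) w0), scale (- b) ((N ^^ (m - 1)) w1)] = [0, 0]"
      using decomp[of 0] by blast
    then show ?thesis using top[of w0] top[of w1] by simp
  qed
  then show ?thesis using that nil span unfolding S_def by blast
qed

end

section \<open>Indecomposability, and a basis with the normal form as Gram matrix\<close>

context nondegenerate_form begin

text \<open>The cyclic summand split off by \<open>u\<close> would be the whole space, whose image
  under \<open>N ^^ (m - 1)\<close> is then a line; the two independent vectors of
  \<open>indep\<close> do not fit into it.\<close>

lemma indecomposable_imp_alternating:
  fixes \<epsilon> :: 'a
  assumes indec: "indecomposable scale f" and "\<epsilon> \<in> {1, -1}" "m \<ge> 1"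
  defines "N \<equiv> \<lambda>v. \<sigma> v - scale \<epsilon> v"
  assumes nil: "\<And>v. (N ^^ m) v = 0"
    and indep: "\<And>a b. scale a ((N ^^ (m - 1)) w0) = scale b ((N ^^ (m - 1)) w1) \<Longrightarrow> a = 0 \<and> b = 0"
  shows "f u ((N ^^ (m - 1)) u) = 0"
proof (rule ccontr)
  interpret unipotent_isometry scale f N "\<lambda>v. inv_into UNIV \<sigma> v - scale \<epsilon> v" \<epsilon> m
    unfolding N_def by (rule unipotent_isometry_asymmetry[OF assms(2,3) nil[unfolded N_def]])
  assume nz: "f u ((N ^^ (m - 1)) u) \<noteq> 0"
  then have top: "top_form u u \<noteq> 0" unfolding top_form_def .
  have u0: "u \<noteq> 0" using nz by auto
  have ortho: "orthogonal_sum scale f (orbit_span 0 u) {y. \<forall>x\<in>orbit_span 0 u. f x y = 0}"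
    by (rule orbit_span_complement[OF top])
  then have "orbit_span 0 u = {0} \<or> {y. \<forall>x\<in>orbit_span 0 u. f x y = 0} = {0}"
    using indec unfolding indecomposable_def by blast
  then have W: "{y. \<forall>x\<in>orbit_span 0 u. f x y = 0} = {0}" using self_in_orbit_span[of u] u0 by auto
  have "v \<in> orbit_span 0 u" for v
  proof -
    have "v \<in> {x + w | x w. x \<in> orbit_span 0 u \<and> w \<in> {0}}"
      using ortho unfolding orthogonal_sum_def W by simp
    then show ?thesis by auto
  qed
  \<comment> \<open>Every vector is a multiple of \<open>u\<close> modulo
    \<open>orbit_span 1 u\<close>, which \<open>N ^^ (m - 1)\<close> annihilates.\<close>
  then have 1: "\<exists>b. v - scale b u \<in> orbit_span 1 u" for v
    using orbit_span_leading[of v 0 u] by simp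
  have 2: "(N ^^ (m - 1)) x = 0" if "x \<in> orbit_span 1 u" for x
  proof -
    have "(N ^^ (m - 1)) x \<in> orbit_span (m - 1 + 1) u" by (rule N_pow_orbit_span[OF that])
    then show ?thesis
      by (induction rule: orbit_span_induct) (use \<open>m \<ge> 1\<close> in \<open>auto simp: N_pow_ge\<close>)
  qed
  have ex: "\<exists>b. (N ^^ (m - 1)) v = scale b ((N ^^ (m - 1)) u)" for v
  proof -
    obtain b where "v - scale b u \<in> orbit_span 1 u" using 1 by blast
    then have "(N ^^ (m - 1)) (v - scale b u) = 0" by (rule 2)
    then show ?thesis by (intro exI[of _ b]) simp
  qed
  obtain a b where ab: "(N ^^ (m - 1)) w0 = scale a ((N ^^ (m - 1)) u)"
    "(N ^^ (m - 1)) w1 = scale b ((N ^^ (m - 1)) u)" using ex[of w0] ex[of w1] by blast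
  \<comment> \<open>Cross-multiplication gives a linear relation that forces \<open>a = 0\<close>,
    hence \<open>(N ^^ (m - 1)) w0 = 0\<close>, which \<open>indep\<close> excludes.\<close>
  have "scale b ((N ^^ (m - 1)) w0) = scale a ((N ^^ (m - 1)) w1)"
    unfolding ab scale_scale by (simp only: mult.commute)
  then have "a = 0" using indep by blast
  then have "scale 1 ((N ^^ (m - 1)) w0) = scale 0 ((N ^^ (m - 1)) w1)" unfolding ab by simp
  then show False using indep[of 1 0] one_neq_zero by blast
qed

end

lemma normal_form_matrix_index:
  assumes "i < 2 * m" "j < 2 * m"
  shows "normal_form_matrix m a $$ (i, j) =
    (if i < m then if j < m then 0 else jordan_block m a $$ (i, j - m)
     else if j < m then if i = m + j then 1 else 0 else 0)"
  using assms unfolding normal_form_matrix_def lower_jordan_block_def by auto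

text \<open>The identity block of the Gram matrix makes the \<open>2 * m\<close> vectors
  independent; they span because the generators of the two cyclic submodules bound the dimension by
  \<open>2 * m\<close>.\<close>

lemma normal_form_basis:
  fixes scale :: "'a::field \<Rightarrow> 'v::ab_group_add \<Rightarrow> 'v"
  assumes form: "equal_pair_form scale f \<epsilon> m"
    and quadratic: "(2::'a) \<noteq> 0 \<or> (\<forall>c::'a. \<exists>t. t * t + t + c = 0)"
  shows "\<exists>vs. is_basis scale vs \<and> gram_matrix f vs = normal_form_matrix m \<epsilon> \<and> length vs = 2 * m"
proof -
  obtain B where "finite_dimensional_vector_space scale B"
    using form unfolding equal_pair_form_def by auto
  then interpret nondegenerate_form scale B f
    using form unfolding equal_pair_form_def
    by (intro nondegenerate_form.intro nondegenerate_form_axioms.intro) auto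
  have eps: "\<epsilon> \<in> {1, -1}" and m: "m \<ge> 1" and indec: "indecomposable scale f"
    and ed: "has_elementary_divisors scale \<sigma> {#[:-\<epsilon>, 1:] ^ m, [:-\<epsilon>, 1:] ^ m#}"
    using form unfolding equal_pair_form_def by auto
  define N where "N = (\<lambda>v. \<sigma> v - scale \<epsilon> v)"
  obtain w0 w1 where nil: "\<And>v. (N ^^ m) v = 0"
    and sp: "span ((\<lambda>i. (N ^^ i) w0) ` {..<m} \<union> (\<lambda>i. (N ^^ i) w1) ` {..<m}) = UNIV"
    and indep: "\<And>a b. scale a ((N ^^ (m - 1)) w0) = scale b ((N ^^ (m - 1)) w1) \<Longrightarrow> a = 0 \<and> b = 0"
    using equal_pair_generators[OF asymmetry_linear m ed] unfolding N_def by blast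
  interpret unipotent_isometry scale f N "\<lambda>v. inv_into UNIV \<sigma> v - scale \<epsilon> v" \<epsilon> m
    unfolding N_def by (rule unipotent_isometry_asymmetry[OF eps m nil[unfolded N_def]])
  have alt: "top_form v v = 0" for v
    using indecomposable_imp_alternating[OF indec eps m, of w0 w1 v, folded N_def] nil indep
    unfolding top_form_def by blast
  have "(N ^^ (m - 1)) w0 \<noteq> 0"
  proof
    assume "(N ^^ (m - 1)) w0 = 0"
    then have "scale 1 ((N ^^ (m - 1)) w0) = scale 0 ((N ^^ (m - 1)) w1)" by simp
    then show False using indep[of 1 0] one_neq_zero by blast
  qed
  then obtain u where "top_form u w0 \<noteq> 0" using form_right_eq_0 unfolding top_form_def by blast
  then obtain vs where vs: "length vs = 2 * m" "gram_matrix f vs = normal_form_matrix m \<epsilon>"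
    by (rule normal_form_gram_exists[OF quadratic alt])
  have gram: "f (vs ! i) (vs ! j) = normal_form_matrix m \<epsilon> $$ (i, j)" if "i < 2 * m" "j < 2 * m" for i j
    using that vs(1) unfolding vs(2)[symmetric] gram_matrix_def by simp
  have low: "f (vs ! (m + i)) (vs ! j) = (if i = j then 1 else 0)" if "i < m" "j < 2 * m" for i j
  proof -
    have "m + i < 2 * m" using that by linarith
    from gram[OF this that(2)] show ?thesis
      unfolding normal_form_matrix_index[OF \<open>m + i < 2 * m\<close> that(2)] using that(1) by simp
  qed
  have left: "f (vs ! j) (vs ! (i - m)) = (if i = j then 1 else 0)"
    if "m \<le> i" "i < 2 * m" "j < 2 * m" for i j
  proof -
    have im: "i - m < 2 * m" "i - m < m" "m + (i - m) = i" using that by linarith+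
    from gram[OF that(3) im(1)] show ?thesis
      unfolding normal_form_matrix_index[OF that(3) im(1)] using im that(1) by auto
  qed
  \<comment> \<open>The identity block is read in two ways: its rows, as left arguments, are dual to
    the first half of \<open>vs\<close>, its columns, as right arguments, to the second
    half.\<close>
  define \<phi> where "\<phi> i v = (if i < m then f (vs ! (m + i)) v else f v (vs ! (i - m)))" for i v
  have "distinct vs \<and> independent (set vs)"
  proof (rule independent_if_dual_functionals[where \<phi> = \<phi>])
    fix i j assume "i < length vs" "j < length vs"
    then show "\<phi> i (vs ! j) = (if i = j then 1 else 0)"
      using low[of i j] left[of i j] unfolding vs(1) \<phi>_def by (cases "i < m") simp_all
  qed (simp_all add: \<phi>_def)
  then have dist: "distinct vs" and indep_vs: "independent (set vs)" by blast+
  have "span (set vs) = UNIV"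
  proof -
    let ?S = "(\<lambda>i. (N ^^ i) w0) ` {..<m} \<union> (\<lambda>i. (N ^^ i) w1) ` {..<m}"
    have "dim (UNIV :: 'v set) \<le> card ?S" by (rule dim_le_card) (use sp in auto)
    also have "\<dots> \<le> card ((\<lambda>i. (N ^^ i) w0) ` {..<m}) + card ((\<lambda>i. (N ^^ i) w1) ` {..<m})"
      by (rule card_Un_le)
    also have "\<dots> \<le> m + m" by (intro add_mono card_image_le[THEN order_trans]) auto
    finally have "dim (UNIV :: 'v set) \<le> card (set vs)"
      using vs(1) distinct_card[OF dist] by linarith
    then show ?thesis
      using card_ge_dim_independent[OF _ indep_vs, of UNIV] by blast
  qed
  then show ?thesis using vs dist indep_vs unfolding is_basis_def by blast
qed

subsection \<open>Artin--Schreier extensions in characteristic 2\<close>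

text \<open>A factorisation without constant factor has linear factors, and a linear factor has a
  root.\<close>

lemma irreducible_quadratic_if_no_root:
  fixes b c :: "'a::field"
  assumes "\<And>t. t * t + b * t + c \<noteq> 0"
  shows "Factorial_Ring.irreducible [:c, b, 1:]"
proof (rule Factorial_Ring.irreducibleI)
  fix p q assume eq: "[:c, b, 1:] = p * q"
  have no_root: "poly [:c, b, 1:] t \<noteq> 0" for t
    using assms[of t] by (simp add: algebra_simps)
  have nz: "p \<noteq> 0" "q \<noteq> 0" using eq by auto
  have "Polynomial.degree p + Polynomial.degree q = 2"
    using Polynomial.degree_mult_eq[OF nz] unfolding eq[symmetric] by simp
  then have "Polynomial.degree p = 0 \<or> Polynomial.degree q = 0 \<or> Polynomial.degree p = 1" by linarith
  moreover have "Polynomial.degree p \<noteq> 1"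
  proof
    assume deg: "Polynomial.degree p = 1"
    then have lc: "Polynomial.coeff p 1 \<noteq> 0" using nz(1) Polynomial.leading_coeff_0_iff by metis
    have "poly p t = Polynomial.coeff p 0 + Polynomial.coeff p 1 * t" for t
      unfolding poly_altdef deg by simp
    then have "poly p (- Polynomial.coeff p 0 / Polynomial.coeff p 1) = 0" using lc by simp
    then show False using no_root eq by (metis mult_zero_left poly_mult)
  qed
  ultimately show "p dvd 1 \<or> q dvd 1" using nz is_unit_iff_degree by blast
qed (auto simp: is_unit_iff_degree)

text \<open>The pair \<open>(x, y)\<close> stands for \<open>x + y \<alpha>\<close> with \<open>\<alpha>\<^sup>2 = \<alpha> + c\<close>.\<close>

definition artin_schreier_ring :: "'a::field \<Rightarrow> ('a \<times> 'a) ring" where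
  "artin_schreier_ring c = \<lparr>carrier = UNIV,
     monoid.mult = (\<lambda>p q. (fst p * fst q + c * snd p * snd q, fst p * snd q + snd p * fst q + snd p * snd q)),
     one = (1, 0), ring.zero = (0, 0), add = (\<lambda>p q. (fst p + fst q, snd p + snd q))\<rparr>"

lemma artin_schreier_ring_simps [simp]:
  "carrier (artin_schreier_ring c) = UNIV"
  "p \<otimes>\<^bsub>artin_schreier_ring c\<^esub> q
     = (fst p * fst q + c * snd p * snd q, fst p * snd q + snd p * fst q + snd p * snd q)"
  "\<one>\<^bsub>artin_schreier_ring c\<^esub> = (1, 0)"
  "\<zero>\<^bsub>artin_schreier_ring c\<^esub> = (0, 0)"
  "p \<oplus>\<^bsub>artin_schreier_ring c\<^esub> q = (fst p + fst q, snd p + snd q)"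
  unfolding artin_schreier_ring_def by simp_all

lemma artin_schreier_cring: "cring (artin_schreier_ring c)"
proof (rule cringI)
  show "abelian_group (artin_schreier_ring c)"
  proof (rule abelian_groupI)
    fix x :: "'a \<times> 'a"
    show "\<exists>y\<in>carrier (artin_schreier_ring c). y \<oplus>\<^bsub>artin_schreier_ring c\<^esub> x = \<zero>\<^bsub>artin_schreier_ring c\<^esub>"
      by (rule bexI[of _ "(- fst x, - snd x)"]) simp_all
  qed (simp_all add: algebra_simps)
  show "comm_monoid (artin_schreier_ring c)"
    by (rule comm_monoidI) (simp_all add: algebra_simps)
qed (simp_all add: algebra_simps)

text \<open>The norm of \<open>a + b \<alpha>\<close> with \<open>b \<noteq> 0\<close> is
  \<open>b * b\<close> times the value of the Artin--Schreier polynomial at \<open>a / b\<close>,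
  hence nonzero; this gives inverses. The minimal polynomial of such an element has the nonzero
  constant \<open>b\<close> as derivative.\<close>

lemma artin_schreier_separable_extension:
  fixes c :: "'a::field"
  assumes two: "(2::'a) = 0" and no_root: "\<And>t. t * t + t + c \<noteq> 0"
  shows "separable_quadratic_extension (artin_schreier_ring c) (\<lambda>a. (a, 0))"
proof -
  let ?K = "artin_schreier_ring c"
  interpret K: cring ?K by (rule artin_schreier_cring)
  have double: "x + x = 0" for x :: 'a using two by (metis mult_2 mult_zero_left)
  have double': "x + (x + y) = y" for x y :: 'a using double[of x] by (simp flip: add.assoc)
  have norm: "a * a + a * b + c * b * b \<noteq> 0" if "b \<noteq> 0" for a b
  proof
    assume "a * a + a * b + c * b * b = 0"
    moreover have "a * a + a * b + c * b * b = b * b * (a / b * (a / b) + a / b + c)"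
      using that by (simp add: field_simps)
    ultimately show False using no_root[of "a / b"] that by simp
  qed
  have field: "field ?K"
  proof (rule K.cring_fieldI2)
    fix p assume "p \<noteq> \<zero>\<^bsub>?K\<^esub>"
    obtain a b where p: "p = (a, b)" by (cases p)
    define n where "n = a * a + a * b + c * b * b"
    have n: "n \<noteq> 0" using norm[of b a] \<open>p \<noteq> _\<close> unfolding n_def p by (cases "b = 0") auto
    \<comment> \<open>The inverse is the conjugate \<open>(a + b) + b \<alpha>\<close> divided by
      the norm \<open>n\<close>.\<close>
    have "a * ((a + b) / n) + c * b * (b / n) = (a * a + a * b + c * b * b) / n"
      by (simp add: add_divide_distrib algebra_simps)
    then have 1: "a * ((a + b) / n) + c * b * (b / n) = 1" using n unfolding n_def by simp
    have "a * (b / n) + b * ((a + b) / n) + b * (b / n) = (a * b + a * b + (b * b + b * b)) / n"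
      by (simp add: add_divide_distrib algebra_simps)
    then have "a * (b / n) + b * ((a + b) / n) + b * (b / n) = 0" by (simp only: double) simp
    then show "\<exists>q\<in>carrier ?K. p \<otimes>\<^bsub>?K\<^esub> q = \<one>\<^bsub>?K\<^esub>"
      using 1 unfolding p by (intro bexI[of _ "((a + b) / n, b / n)"]) simp_all
  qed simp
  have hom: "(\<lambda>a. (a, 0)) \<in> Ring.ring_hom base_ring ?K"
    by (rule Ring.ring_hom_memI) (simp_all add: base_ring_def)
  have dim: "K.dimension 2 (range (\<lambda>a. (a, 0))) (carrier ?K)"
  proof -
    let ?F = "range (\<lambda>a::'a. (a, 0::'a))"
    \<comment> \<open>The line of 1 over the zero space is the base field; adding the line of
      \<open>\<alpha>\<close> gives everything.\<close>
    have "K.dimension (Suc 0) ?F (K.line_extension ?F (1, 0) {\<zero>\<^bsub>?K\<^esub>})"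
      by (rule K.Suc_dim[OF _ _ K.zero_dim]) simp_all
    moreover have "K.line_extension ?F (1, 0) {\<zero>\<^bsub>?K\<^esub>} = ?F"
      by (auto simp: K.line_extension_mem_iff set_eq_iff)
    ultimately have "K.dimension (Suc 0) ?F ?F" by (simp only:)
    then have "K.dimension (Suc (Suc 0)) ?F (K.line_extension ?F (0, 1) ?F)"
      by (intro K.Suc_dim) auto
    moreover have "K.line_extension ?F (0, 1) ?F = carrier ?K"
      by (auto simp: K.line_extension_mem_iff set_eq_iff)
    ultimately show ?thesis by (simp only: numeral_2_eq_2)
  qed
  have sep: "\<exists>q. Factorial_Ring.irreducible q \<and> coprime q (pderiv q) \<and>
      poly_eval_ext ?K (\<lambda>a. (a, 0)) q x = \<zero>\<^bsub>?K\<^esub>" for x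
  proof -
    obtain a b where x: "x = (a, b)" by (cases x)
    show ?thesis
    proof (cases "b = 0")
      case True
      have "Factorial_Ring.irreducible [:-a, 1:]" by (rule irreducible_linear_field_poly) simp
      moreover have "coprime [:-a, 1:] (pderiv [:-a, 1:])"
        by (rule is_unit_right_imp_coprime) (simp add: pderiv_pCons is_unit_iff_degree)
      moreover have "poly_eval_ext ?K (\<lambda>a. (a, 0)) [:-a, 1:] x = \<zero>\<^bsub>?K\<^esub>"
        unfolding poly_eval_ext_def x True by (simp add: K.finsum_Suc Pi_def)
      ultimately show ?thesis by blast
    next
      case False
      \<comment> \<open>In characteristic 2, \<open>x\<close> has trace \<open>b\<close> and norm
        \<open>n\<close>, so \<open>?q\<close> is its characteristic polynomial.\<close>
      define n where "n = a * a + a * b + c * b * b"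
      let ?q = "[:n, b, 1:]"
      have "t * t + b * t + n \<noteq> 0" for t
      proof -
        have "(t + a) * (t + a) + (t + a) * b + c * b * b = t * t + b * t + n + (t * a + t * a)"
          unfolding n_def by (simp add: algebra_simps)
        then show ?thesis using norm[OF False, of "t + a"] double[of "t * a"] by simp
      qed
      then have "Factorial_Ring.irreducible ?q" by (rule irreducible_quadratic_if_no_root)
      moreover have "pderiv ?q = [:b:]" using two by (simp add: pderiv_pCons)
      then have "coprime ?q (pderiv ?q)"
        using False by (intro is_unit_right_imp_coprime) (simp add: is_unit_iff_degree)
      moreover have "poly_eval_ext ?K (\<lambda>a. (a, 0)) ?q x = \<zero>\<^bsub>?K\<^esub>"
      proof -
        have "poly_eval_ext ?K (\<lambda>a. (a, 0)) ?q x =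
            ((1, 0) \<otimes>\<^bsub>?K\<^esub> (x \<otimes>\<^bsub>?K\<^esub> x)) \<oplus>\<^bsub>?K\<^esub> (((b, 0) \<otimes>\<^bsub>?K\<^esub> x) \<oplus>\<^bsub>?K\<^esub> (n, 0))"
          unfolding poly_eval_ext_def by (simp add: K.finsum_Suc Pi_def numeral_2_eq_2 nat_pow_def)
        also have "\<dots> = (0, 0)"
          unfolding x n_def by (simp add: algebra_simps double double')
        finally show ?thesis by simp
      qed
      ultimately show ?thesis by blast
    qed
  qed
  show ?thesis
    unfolding separable_quadratic_extension_def using field hom dim sep by blast
qed

lemma artin_schreier_root_exists:
  fixes c :: "'a::field"
  assumes "(2::'a) = 0" "\<not> has_separable_quadratic_extension TYPE('a)"
  shows "\<exists>t. t * t + t + c = 0"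
  using assms artin_schreier_separable_extension unfolding has_separable_quadratic_extension_def by blast

subsection \<open>Equivalence of forms\<close>

lemma basis_map_exists:
  assumes "vector_space scaleV" "vector_space scaleW" "is_basis scaleV vs" "length vs = length ws"
  obtains y where "Vector_Spaces.linear scaleV scaleW y" "\<And>i. i < length vs \<Longrightarrow> y (vs ! i) = ws ! i"
proof -
  interpret vector_space_pair scaleV scaleW using assms(1,2) by (rule vector_space_pair.intro)
  have "vs1.independent (set vs)" and dist: "distinct vs" using assms(3) unfolding is_basis_def by auto
  then obtain y where "Vector_Spaces.linear scaleV scaleW y" "\<forall>v\<in>set vs. y v = the (map_of (zip vs ws) v)"
    using linear_independent_extend[of "set vs" "\<lambda>v. the (map_of (zip vs ws) v)"] by blast
  moreover have "map_of (zip vs ws) (vs ! i) = Some (ws ! i)" if "i < length vs" for i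
    using that assms(4) dist by (simp add: map_of_zip_nth)
  ultimately show ?thesis by (intro that[of y]) simp_all
qed

lemma linear_eq_id_on_basis:
  assumes "is_basis scale vs" "Vector_Spaces.linear scale scale y" "\<And>i. i < length vs \<Longrightarrow> y (vs ! i) = vs ! i"
  shows "y v = v"
proof -
  interpret y: Vector_Spaces.linear scale scale y by (rule assms)
  have span: "y.vs1.span (set vs) = UNIV" using assms(1) unfolding is_basis_def by simp
  show ?thesis
    by (rule y.vs1.span_UNIV_induct[OF span, of "\<lambda>v. y v = v"])
      (use assms(3) in \<open>auto simp: y.add y.scale y.zero in_set_conv_nth\<close>)
qed

text \<open>The linear maps matching the two bases are inverse to each other, and bilinearity
  extends the agreement from pairs of basis vectors to all pairs.\<close>

lemma equivalent_forms_if_equal_gram: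
  assumes "vector_space scaleV" "vector_space scaleW"
    and f: "bilinear_form scaleV f" and g: "bilinear_form scaleW g"
    and vs: "is_basis scaleV vs" and ws: "is_basis scaleW ws" and gram: "gram_matrix f vs = gram_matrix g ws"
  shows "equivalent_forms scaleV f scaleW g"
proof -
  interpret V: vector_space scaleV by fact
  have len: "length vs = length ws"
    using gram unfolding gram_matrix_def by (metis dim_row_mat(1))
  obtain y where y: "Vector_Spaces.linear scaleV scaleW y" "\<And>i. i < length vs \<Longrightarrow> y (vs ! i) = ws ! i"
    using basis_map_exists[OF assms(1,2) vs len] by blast
  obtain z where z: "Vector_Spaces.linear scaleW scaleV z" "\<And>i. i < length ws \<Longrightarrow> z (ws ! i) = vs ! i"
    using basis_map_exists[OF assms(2,1) ws len[symmetric]] by blast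
  interpret y: Vector_Spaces.linear scaleV scaleW y by (rule y(1))
  have "(z \<circ> y) v = v" for v
  proof (rule linear_eq_id_on_basis[OF vs])
    show "Vector_Spaces.linear scaleV scaleV (z \<circ> y)"
      using y(1) z(1) by (auto simp: Vector_Spaces.linear_iff)
  qed (use y(2) z(2) len in simp)
  moreover have "(y \<circ> z) w = w" for w
  proof (rule linear_eq_id_on_basis[OF ws])
    show "Vector_Spaces.linear scaleW scaleW (y \<circ> z)"
      using y(1) z(1) by (auto simp: Vector_Spaces.linear_iff)
  qed (use y(2) z(2) len in simp)
  ultimately have bij: "bij y" by (intro o_bij[of z]) auto
  have nth: "f (vs ! i) (vs ! j) = g (ws ! i) (ws ! j)" if "i < length vs" "j < length vs" for i j
  proof -
    have "gram_matrix f vs $$ (i, j) = gram_matrix g ws $$ (i, j)" unfolding gram ..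
    then show ?thesis using that len unfolding gram_matrix_def by simp
  qed
  note fs = bilinear_form_simps[OF f] and gs = bilinear_form_simps[OF g]
  note zero = bilinear_form_zero[OF f] bilinear_form_zero[OF g]
  have span: "V.span (set vs) = UNIV" using vs unfolding is_basis_def by simp
  have "g (y u) (y v) = f u v" for u v
  proof (rule V.span_UNIV_induct[OF span, of "\<lambda>u. g (y u) (y v) = f u v"])
    fix u assume "u \<in> set vs"
    then obtain i where i: "i < length vs" "u = vs ! i" by (auto simp: in_set_conv_nth)
    show "g (y u) (y v) = f u v"
    proof (rule V.span_UNIV_induct[OF span, of "\<lambda>v. g (y u) (y v) = f u v"])
      fix v assume "v \<in> set vs"
      then obtain j where "j < length vs" "v = vs ! j" by (auto simp: in_set_conv_nth)
      then show "g (y u) (y v) = f u v" using i y(2) nth by simp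
    qed (simp_all add: fs gs y.add y.scale y.zero zero)
  qed (simp_all add: fs gs y.add y.scale y.zero zero)
  then show ?thesis unfolding equivalent_forms_def using y(1) bij by blast
qed

section \<open>Recovering \<open>\<epsilon>\<close> and \<open>m\<close> from the similarity
  type\<close>

lemma equal_pair_asymmetry:
  assumes "equal_pair_form scale f \<epsilon> m"
  defines "N \<equiv> \<lambda>v. asymmetry scale f v - scale \<epsilon> v"
  shows "vector_space scale" "Vector_Spaces.linear scale scale (asymmetry scale f)"
    "(N ^^ m) v = 0" "\<exists>v. (N ^^ (m - 1)) v \<noteq> 0"
proof -
  obtain B where "finite_dimensional_vector_space scale B"
    using assms(1) unfolding equal_pair_form_def by auto
  then interpret nondegenerate_form scale B f
    using assms(1) unfolding equal_pair_form_def
    by (intro nondegenerate_form.intro nondegenerate_form_axioms.intro) auto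
  show "vector_space scale" by (rule vector_space_axioms)
  show lin: "Vector_Spaces.linear scale scale (asymmetry scale f)" by (rule asymmetry_linear)
  have m: "m \<ge> 1" and ed: "has_elementary_divisors scale (asymmetry scale f) {#[:-\<epsilon>, 1:] ^ m, [:-\<epsilon>, 1:] ^ m#}"
    using assms(1) unfolding equal_pair_form_def by auto
  obtain w0 w1 where nil: "\<And>v. (N ^^ m) v = 0"
    and "module.span scale ((\<lambda>i. (N ^^ i) w0) ` {..<m} \<union> (\<lambda>i. (N ^^ i) w1) ` {..<m}) = UNIV"
    and indep: "\<And>a b. scale a ((N ^^ (m - 1)) w0) = scale b ((N ^^ (m - 1)) w1) \<Longrightarrow> a = 0 \<and> b = 0"
    using equal_pair_generators[OF lin m ed] unfolding N_def by blast
  show "(N ^^ m) v = 0" by (rule nil)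
  have "(N ^^ (m - 1)) w0 \<noteq> 0"
  proof
    assume "(N ^^ (m - 1)) w0 = 0"
    then have "scale 1 ((N ^^ (m - 1)) w0) = scale 0 ((N ^^ (m - 1)) w1)" by simp
    then show False using indep[of 1 0] one_neq_zero by blast
  qed
  then show "\<exists>v. (N ^^ (m - 1)) v \<noteq> 0" by blast
qed

text \<open>The eigenvalue of the asymmetry and the nilpotency index of the shifted map are
  similarity invariants; by \<open>equal_pair_asymmetry\<close> this index is exactly
  \<open>m\<close>, respectively \<open>k\<close>.\<close>

lemma similar_equal_pair_parameters:
  assumes f: "equal_pair_form scaleV f \<epsilon> m" and g: "equal_pair_form scaleW g \<delta> k"
    and sim: "similar_maps scaleV (asymmetry scaleV f) scaleW (asymmetry scaleW g)"
  shows "\<epsilon> = \<delta>" "m = k"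
proof -
  let ?N = "\<lambda>v. asymmetry scaleV f v - scaleV \<epsilon> v" and ?M = "\<lambda>v. asymmetry scaleW g v - scaleW \<delta> v"
  obtain x where lin: "Vector_Spaces.linear scaleV scaleW x" and bij: "bij x"
    and x: "\<And>v. x (asymmetry scaleV f v) = asymmetry scaleW g (x v)"
    using sim unfolding similar_maps_def by blast
  interpret x: Vector_Spaces.linear scaleV scaleW x by (rule lin)
  interpret \<tau>: Vector_Spaces.linear scaleW scaleW "asymmetry scaleW g"
    by (rule equal_pair_asymmetry(2)[OF g])
  note nilN = equal_pair_asymmetry(3)[OF f] and nilM = equal_pair_asymmetry(3)[OF g]
  have m: "m \<ge> 1" and k: "k \<ge> 1" using f g unfolding equal_pair_form_def by auto
  have x0: "x v = 0 \<longleftrightarrow> v = 0" for v using bij x.zero by (metis bij_pointE)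
  obtain w where w: "(?N ^^ (m - 1)) w \<noteq> 0" using equal_pair_asymmetry(4)[OF f] by blast
  obtain w' where w': "(?M ^^ (k - 1)) w' \<noteq> 0" using equal_pair_asymmetry(4)[OF g] by blast
  \<comment> \<open>The last nonvanishing power of \<open>?N\<close> on \<open>w\<close> is an
    eigenvector of the asymmetry for \<open>\<epsilon>\<close>.\<close>
  define z where "z = (?N ^^ (m - 1)) w"
  have "?N z = (?N ^^ m) w"
    unfolding z_def using m funpow.simps(2)[of "m - 1" ?N] by simp
  then have "asymmetry scaleV f z = scaleV \<epsilon> z" using nilN by simp
  then have eig: "asymmetry scaleW g (x z) = scaleW \<epsilon> (x z)" by (simp flip: x add: x.scale)
  \<comment> \<open>On this eigenvector \<open>?M\<close> is multiplication by
    \<open>\<epsilon> - \<delta>\<close>, which nilpotency makes zero.\<close>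
  have "(?M ^^ i) (x z) = scaleW ((\<epsilon> - \<delta>) ^ i) (x z)" for i
    by (induction i) (simp_all add: \<tau>.scale eig x.vs2.scale_left_diff_distrib algebra_simps)
  from this[of k] have "scaleW ((\<epsilon> - \<delta>) ^ k) (x z) = 0" using nilM by simp
  then show eq: "\<epsilon> = \<delta>" using w x0 unfolding z_def by simp
  have pow: "x ((?N ^^ i) v) = (?M ^^ i) (x v)" for i v
    by (induction i) (simp_all add: x.diff x.scale x eq)
  have later: "(F ^^ i) v = 0" if "\<And>v. (F ^^ j) v = 0" "j \<le> i" for F :: "'z \<Rightarrow> 'z::zero" and i j v
  proof -
    have "(F ^^ (j + (i - j))) v = 0" unfolding funpow_add o_apply by (rule that(1))
    then show ?thesis using that(2) by simp
  qed
  have "(?N ^^ k) v = 0" for v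
  proof -
    have "x ((?N ^^ k) v) = 0" unfolding pow by (rule nilM)
    then show ?thesis by (simp only: x0)
  qed
  then have "\<not> k \<le> m - 1" using later[of k ?N "m - 1" w] w by blast
  moreover have "(?M ^^ m) u = 0" for u
  proof -
    have "(?M ^^ m) (x (inv_into UNIV x u)) = 0" unfolding pow[symmetric] nilN by (rule x.zero)
    then show ?thesis using bij by (simp only: bij_is_surj surj_f_inv_f)
  qed
  then have "\<not> m \<le> k - 1" using later[of m ?M "k - 1" w'] w' by blast
  ultimately show "m = k" using m k by linarith
qed

theorem theorem7p1:
  fixes scaleV :: "'a::field \<Rightarrow> 'v::ab_group_add \<Rightarrow> 'v"
    and f :: "'v \<Rightarrow> 'v \<Rightarrow> 'a" and \<epsilon> :: 'a and m :: nat
  assumes "equal_pair_form scaleV f \<epsilon> m"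
  shows
    "(CHAR('a) \<noteq> 2 \<longrightarrow>
        (\<exists>vs. is_basis scaleV vs \<and> gram_matrix f vs = normal_form_matrix m \<epsilon>) \<and>
        (\<forall>(scaleW :: 'a \<Rightarrow> 'w::ab_group_add \<Rightarrow> 'w) g \<delta> k.
           equal_pair_form scaleW g \<delta> k \<and>
           similar_maps scaleV (asymmetry scaleV f) scaleW (asymmetry scaleW g) \<longrightarrow>
           equivalent_forms scaleV f scaleW g)) \<and>
     (CHAR('a) = 2 \<and> \<not> has_separable_quadratic_extension TYPE('a) \<longrightarrow>
        (\<exists>vs. is_basis scaleV vs \<and> gram_matrix f vs = normal_form_matrix m \<epsilon>) \<and>
        (\<forall>(scaleW :: 'a \<Rightarrow> 'w::ab_group_add \<Rightarrow> 'w) g \<delta> k.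
           equal_pair_form scaleW g \<delta> k \<and>
           similar_maps scaleV (asymmetry scaleV f) scaleW (asymmetry scaleW g) \<longrightarrow>
           equivalent_forms scaleV f scaleW g))"
proof -
  \<comment> \<open>In characteristic 2 solvability of the Artin--Schreier equations stands in for
    the hypothesis on extensions, so that one argument serves both cases.\<close>
  have main: "(\<exists>vs. is_basis scaleV vs \<and> gram_matrix f vs = normal_form_matrix m \<epsilon>) \<and>
      (\<forall>(scaleW :: 'a \<Rightarrow> 'w::ab_group_add \<Rightarrow> 'w) g \<delta> k.
         equal_pair_form scaleW g \<delta> k \<and>
         similar_maps scaleV (asymmetry scaleV f) scaleW (asymmetry scaleW g) \<longrightarrow>
         equivalent_forms scaleV f scaleW g)"
    if quadratic: "(2::'a) \<noteq> 0 \<or> (\<forall>c::'a. \<exists>t. t * t + t + c = 0)"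
  proof (intro conjI allI impI)
    obtain vs where vs: "is_basis scaleV vs" "gram_matrix f vs = normal_form_matrix m \<epsilon>"
      using normal_form_basis[OF assms quadratic] by blast
    then show "\<exists>vs. is_basis scaleV vs \<and> gram_matrix f vs = normal_form_matrix m \<epsilon>" by blast
    fix scaleW :: "'a \<Rightarrow> 'w \<Rightarrow> 'w" and g \<delta> k
    assume "equal_pair_form scaleW g \<delta> k \<and>
      similar_maps scaleV (asymmetry scaleV f) scaleW (asymmetry scaleW g)"
    then have g: "equal_pair_form scaleW g \<delta> k"
      and sim: "similar_maps scaleV (asymmetry scaleV f) scaleW (asymmetry scaleW g)" by blast+
    obtain ws where ws: "is_basis scaleW ws" "gram_matrix g ws = normal_form_matrix k \<delta>"
      using normal_form_basis[OF g quadratic] by blast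
    have "gram_matrix f vs = gram_matrix g ws"
      unfolding vs(2) ws(2) similar_equal_pair_parameters[OF assms g sim] ..
    moreover have "bilinear_form scaleV f" "bilinear_form scaleW g"
      using assms g unfolding equal_pair_form_def by blast+
    ultimately show "equivalent_forms scaleV f scaleW g"
      using vs(1) ws(1) equal_pair_asymmetry(1)[OF assms] equal_pair_asymmetry(1)[OF g]
      by (intro equivalent_forms_if_equal_gram)
  qed
  \<comment> \<open>The characteristic divides 2 and is not 1, so if it differs from 2 the element 2
    is nonzero.\<close>
  have char: "CHAR('a) = 2" if "(2::'a) = 0"
  proof -
    have "CHAR('a) dvd 2" using that of_nat_eq_0_iff_char_dvd[of 2, where 'a = 'a] by simp
    moreover have "CHAR('a) \<noteq> 1" using of_nat_CHAR[where 'a = 'a] by (metis of_nat_1 one_neq_zero)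
    ultimately show ?thesis using prime_nat_iff two_is_prime_nat by blast
  qed
  have two: "(2::'a) = 0" if "CHAR('a) = 2"
    using of_nat_CHAR[where 'a = 'a] unfolding that by simp
  show ?thesis
    using main char two artin_schreier_root_exists[where 'a = 'a] by meson
qed

end
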